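(* Let $\mathcal H$ be a separable, infinite dimensional Hilbert space and suppose $D$ is a MASA (maximal abelian $*$-subalgebra) in $\mathcal B(\mathcal H)$. There is no regular MASA inclusion $(B,D)$ with $D\subseteq\mathcal B(\mathcal H)\subseteq B$.
   Context: $\mathcal B(\mathcal H)$ is the $C^*$-algebra of bounded operators on $\mathcal H$. An inclusion is a pair $(B,D)$ where $B$ and $D$ are $C^*$-algebras, $D$ is abelian, and $D\subseteq B$ is a $C^*$-subalgebra. The set of normalizers is $N(B,D):=\{n\in B: nDn^*\cup n^*Dn\subseteq D\}$. The inclusion $(B,D)$ is regular if the linear span of $N(B,D)$ is norm-dense in $B$, and it is a MASA inclusion if $D$ is maximal abelian in $B$. The containments $D\subseteq\mathcal B(\mathcal H)\subseteq B$ are containments as $C^*$-subalgebras. *)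

theory Defs
  imports "HOL-Analysis.Analysis"
begin

section \<open>Complex vector spaces and Hilbert spaces\<close>

class complex_vector = real_vector +
  fixes scaleC :: "complex \<Rightarrow> 'a \<Rightarrow> 'a"  (infixr \<open>*\<^sub>C\<close> 75)
  assumes scaleC_add_right: "c *\<^sub>C (x + y) = c *\<^sub>C x + c *\<^sub>C y"
    and scaleC_add_left: "(c + d) *\<^sub>C x = c *\<^sub>C x + d *\<^sub>C x"
    and scaleC_scaleC: "c *\<^sub>C d *\<^sub>C x = (c * d) *\<^sub>C x"
    and scaleC_one: "1 *\<^sub>C x = x"
    and scaleR_scaleC: "r *\<^sub>R x = complex_of_real r *\<^sub>C x"

global_interpretation complex_vector: vector_space "scaleC :: complex \<Rightarrow> 'a \<Rightarrow> 'a::complex_vector"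
  defines cspan = complex_vector.span
    and csubspace = complex_vector.subspace
  by unfold_locales (simp_all add: scaleC_add_right scaleC_add_left scaleC_scaleC scaleC_one)

class complex_normed_vector = complex_vector + real_normed_vector +
  assumes norm_scaleC: "norm (c *\<^sub>C x) = cmod c * norm x"

text \<open>The complex inner product is linear in its first argument. The superclass \<^class>\<open>real_inner\<close>
  only supplies the underlying real inner product, which \<open>Re_cinner\<close> forces to be the real part of
  the complex one; positivity and definiteness of \<open>cinner\<close> are inherited from it, and the norm is
  the one induced by \<open>cinner\<close>.\<close>

class complex_inner = complex_normed_vector + real_inner +
  fixes cinner :: "'a \<Rightarrow> 'a \<Rightarrow> complex"
  assumes cinner_commute: "cinner x y = cnj (cinner y x)"
    and cinner_add_left: "cinner (x + y) z = cinner x z + cinner y z"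
    and cinner_scaleC_left: "cinner (c *\<^sub>C x) y = c * cinner x y"
    and Re_cinner: "Re (cinner x y) = inner x y"

class chilbert_space = complex_inner + banach


section \<open>C*-algebras\<close>

text \<open>C*-algebras are not assumed to be unital.\<close>

class cstar_algebra = complex_normed_vector + real_normed_algebra + banach +
  fixes star :: "'a \<Rightarrow> 'a"
  assumes mult_scaleC_left: "(c *\<^sub>C x) * y = c *\<^sub>C (x * y)"
    and mult_scaleC_right: "x * (c *\<^sub>C y) = c *\<^sub>C (x * y)"
    and star_add: "star (x + y) = star x + star y"
    and star_scaleC: "star (c *\<^sub>C x) = cnj c *\<^sub>C star x"
    and star_mult: "star (x * y) = star y * star x"
    and star_star: "star (star x) = x"
    and cstar_identity: "norm (star x * x) = (norm x)\<^sup>2"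

definition star_subalgebra :: "'a::cstar_algebra set \<Rightarrow> bool" where
  "star_subalgebra A \<longleftrightarrow>
     csubspace A \<and> (\<forall>x\<in>A. \<forall>y\<in>A. x * y \<in> A) \<and> (\<forall>x\<in>A. star x \<in> A)"

definition cstar_subalgebra :: "'a::cstar_algebra set \<Rightarrow> bool" where
  "cstar_subalgebra A \<longleftrightarrow> star_subalgebra A \<and> closed A"

definition abelian :: "'a::cstar_algebra set \<Rightarrow> bool" where
  "abelian A \<longleftrightarrow> (\<forall>x\<in>A. \<forall>y\<in>A. x * y = y * x)"

definition masa :: "'a::cstar_algebra set \<Rightarrow> bool" where
  "masa D \<longleftrightarrow> star_subalgebra D \<and> abelian D \<and>
     (\<forall>A. star_subalgebra A \<and> abelian A \<and> D \<subseteq> A \<longrightarrow> A = D)"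

text \<open>In the following three definitions the large algebra \<open>B\<close> is the whole type \<open>'b\<close>.\<close>

definition normalizers :: "'b::cstar_algebra set \<Rightarrow> 'b set" where
  "normalizers D = {n. (\<lambda>d. n * d * star n) ` D \<union> (\<lambda>d. star n * d * n) ` D \<subseteq> D}"

definition regular_inclusion :: "'b::cstar_algebra set \<Rightarrow> bool" where
  "regular_inclusion D \<longleftrightarrow>
     cstar_subalgebra D \<and> abelian D \<and> closure (cspan (normalizers D)) = UNIV"

definition regular_masa_inclusion :: "'b::cstar_algebra set \<Rightarrow> bool" where
  "regular_masa_inclusion D \<longleftrightarrow> regular_inclusion D \<and> masa D"

text \<open>A map identifying its domain with a C*-subalgebra of its codomain, norm included. No
  preservation of units is required.\<close>

definition cstar_embedding :: "('a::cstar_algebra \<Rightarrow> 'b::cstar_algebra) \<Rightarrow> bool" where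
  "cstar_embedding f \<longleftrightarrow>
     (\<forall>x y. f (x + y) = f x + f y) \<and> (\<forall>c x. f (c *\<^sub>C x) = c *\<^sub>C f x) \<and>
     (\<forall>x y. f (x * y) = f x * f y) \<and> (\<forall>x. f (star x) = star (f x)) \<and>
     (\<forall>x. norm (f x) = norm x)"


section \<open>Existence of adjoints\<close>

lemma riesz_representation_real:
  fixes f :: "'a::{real_inner,complete_space} \<Rightarrow> real"
  assumes "bounded_linear f"
  shows "\<exists>y. \<forall>x. f x = inner x y"
proof -
  interpret f: bounded_linear f by fact
  define J where "J y = (norm y)\<^sup>2 / 2 - f y" for y
  obtain K where K: "\<And>x. \<bar>f x\<bar> \<le> norm x * K" and "K > 0"
    using f.pos_bounded by auto
  have lower: "- K\<^sup>2 / 2 \<le> J y" for y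
  proof -
    have "0 \<le> (norm y - K)\<^sup>2" by simp
    then have "norm y * K \<le> (norm y)\<^sup>2 / 2 + K\<^sup>2 / 2"
      by (simp add: power2_diff algebra_simps)
    with K[of y] show ?thesis by (simp add: J_def)
  qed
  have bdd: "bdd_below (range J)"
    using lower by (auto intro!: bdd_belowI)
  define m where "m = Inf (range J)"
  have m_le: "m \<le> J y" for y
    unfolding m_def by (rule cInf_lower[OF _ bdd]) simp
  have "\<exists>y. J y < m + 1 / real (Suc n)" for n
    using cInf_lessD[of "range J" "m + 1 / real (Suc n)"] by (auto simp: m_def)
  then obtain y where y: "\<And>n. J (y n) < m + 1 / real (Suc n)" by metis
  have par: "(norm (u - v))\<^sup>2 \<le> 4 * (J u + J v - 2 * m)" for u v
  proof -
    have "(norm (u - v))\<^sup>2 + (norm (u + v))\<^sup>2 = 2 * (norm u)\<^sup>2 + 2 * (norm v)\<^sup>2"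
      by (simp add: power2_norm_eq_inner inner_add inner_diff algebra_simps inner_commute)
    moreover have "J ((1/2) *\<^sub>R (u + v)) = (norm (u + v))\<^sup>2 / 8 - (f u + f v) / 2"
      by (simp add: J_def f.scaleR f.add power_mult_distrib power2_eq_square)
    ultimately have "(norm (u - v))\<^sup>2
        \<le> 2 * (norm u)\<^sup>2 + 2 * (norm v)\<^sup>2 - 4 * (f u + f v) - 8 * m"
      using m_le[of "(1/2) *\<^sub>R (u + v)"] by linarith
    then show ?thesis by (simp add: J_def field_simps)
  qed
  have "Cauchy y"
  proof (rule metric_CauchyI)
    fix e :: real assume "e > 0"
    then obtain N where N: "1 / real (Suc N) < e\<^sup>2 / 8"
      using nat_approx_posE[of "e\<^sup>2 / 8"] by auto
    have "dist (y k) (y l) < e" if "k \<ge> N" "l \<ge> N" for k l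
    proof -
      have a: "J (y i) < m + e\<^sup>2 / 8" if "i \<ge> N" for i
      proof -
        have "1 / real (Suc i) \<le> 1 / real (Suc N)" using that by (simp add: frac_le)
        with y[of i] N show ?thesis by linarith
      qed
      have "4 * (J (y k) + J (y l) - 2 * m) < e\<^sup>2"
        using a[OF that(1)] a[OF that(2)] by (simp add: field_simps)
      with par[of "y k" "y l"] have "(norm (y k - y l))\<^sup>2 < e\<^sup>2"
        by (rule le_less_trans)
      then show ?thesis
        using \<open>e > 0\<close> by (simp add: dist_norm power_less_imp_less_base)
    qed
    then show "\<exists>M. \<forall>m\<ge>M. \<forall>n\<ge>M. dist (y m) (y n) < e" by blast
  qed
  then obtain z where z: "y \<longlonglongrightarrow> z"
    using Cauchy_convergent convergent_def by blast
  have "(\<lambda>n. J (y n)) \<longlonglongrightarrow> J z"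
    unfolding J_def by (intro tendsto_intros z f.tendsto) auto
  moreover have "(\<lambda>n. m + 1 / real (Suc n)) \<longlonglongrightarrow> m + 0"
    by (intro tendsto_intros LIMSEQ_Suc lim_1_over_n)
  ultimately have "J z \<le> m + 0"
    by (rule LIMSEQ_le) (use y less_imp_le in blast)
  then have Jz: "J z \<le> J x" for x using m_le[of x] by linarith
  have "f x = inner x z" for x
  proof (cases "x = 0")
    case True then show ?thesis by (simp add: f.zero)
  next
    case False
    define d where "d = f x - inner x z"
    have fx: "f x = inner x z + d" by (simp add: d_def)
    define n where "n = (norm x)\<^sup>2"
    have "n > 0" using False by (simp add: n_def)
    have expand: "(norm (z + t *\<^sub>R x))\<^sup>2 = (norm z)\<^sup>2 + 2 * (t * inner x z) + t\<^sup>2 * n" for t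
      unfolding n_def power2_norm_eq_inner
      by (simp add: inner_add_left inner_add_right inner_commute[of z x] power2_eq_square distrib_left)
    have "0 \<le> J (z + (d / n) *\<^sub>R x) - J z" using Jz by simp
    also have "\<dots> = (d / n) * inner x z + (d / n)\<^sup>2 * n / 2 - (d / n) * f x"
      by (simp add: J_def expand f.add f.scaleR add_divide_distrib)
    also have "\<dots> = - (d / n) * d + (d / n)\<^sup>2 * n / 2"
      by (simp add: fx distrib_left)
    also have "\<dots> = - (d\<^sup>2 / (2 * n))"
      using \<open>n > 0\<close> by (simp add: power2_eq_square field_simps)
    finally have "d\<^sup>2 / (2 * n) \<le> 0" by simp
    then have "d\<^sup>2 \<le> 0" using \<open>n > 0\<close> by (simp add: divide_le_0_iff)
    then show ?thesis by (simp add: d_def)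
  qed
  then show ?thesis by blast
qed

lemma cinner_add_right: "cinner x (y + z) = cinner x y + cinner x z"
  for x :: "'a::complex_inner"
  by (metis cinner_add_left cinner_commute complex_cnj_add)

lemma cinner_scaleC_right: "cinner x (c *\<^sub>C y) = cnj c * cinner x y"
  for x :: "'a::complex_inner"
  by (metis cinner_scaleC_left cinner_commute complex_cnj_mult)

lemma Im_cinner: "Im (cinner x y) = inner ((- \<i>) *\<^sub>C x) y" for x :: "'a::complex_inner"
  by (simp add: Re_cinner[symmetric] cinner_scaleC_left del: complex_vector.scale_minus_left)

lemma cinner_extensionality:
  fixes y z :: "'a::complex_inner"
  assumes "\<And>x. cinner x y = cinner x z"
  shows "y = z"
proof -
  have "inner x y = inner x z" for x
    using assms by (simp add: Re_cinner[symmetric])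
  then have "inner (y - z) (y - z) = 0"
    by (simp add: inner_diff_right)
  then show ?thesis by simp
qed


section \<open>The C*-algebra of bounded operators on a Hilbert space\<close>

typedef (overloaded) 'a bop =
  "{T :: 'a::complex_normed_vector \<Rightarrow>\<^sub>L 'a. \<forall>c x. blinfun_apply T (c *\<^sub>C x) = c *\<^sub>C blinfun_apply T x}"
  morphisms blinfun_of_bop Bop
  by (rule exI[of _ 0]) simp

setup_lifting type_definition_bop

lift_definition bop_apply :: "'a::complex_normed_vector bop \<Rightarrow> 'a \<Rightarrow> 'a" is blinfun_apply .

lemma bop_eqI: "(\<And>x. bop_apply S x = bop_apply T x) \<Longrightarrow> S = T"
  by transfer (rule blinfun_eqI)

lemma bop_apply_scaleC: "bop_apply T (c *\<^sub>C x) = c *\<^sub>C bop_apply T x"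
  by transfer simp

lemma bounded_linear_bop_apply: "bounded_linear (bop_apply T)"
  by transfer (rule blinfun.bounded_linear_right)

instantiation bop :: (complex_normed_vector) complex_normed_vector
begin

lift_definition norm_bop :: "'a bop \<Rightarrow> real" is norm .
lift_definition zero_bop :: "'a bop" is 0 by simp
lift_definition plus_bop :: "'a bop \<Rightarrow> 'a bop \<Rightarrow> 'a bop" is "(+)"
  by (simp add: blinfun.add_left scaleC_add_right)
lift_definition uminus_bop :: "'a bop \<Rightarrow> 'a bop" is uminus
  by (simp add: blinfun.minus_left complex_vector.scale_minus_right)
lift_definition minus_bop :: "'a bop \<Rightarrow> 'a bop \<Rightarrow> 'a bop" is "(-)"
  by (simp add: blinfun.diff_left complex_vector.scale_right_diff_distrib)
lift_definition scaleR_bop :: "real \<Rightarrow> 'a bop \<Rightarrow> 'a bop" is scaleR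
  by (simp add: blinfun.scaleR_left scaleR_scaleC scaleC_scaleC mult.commute)

lemma bounded_linear_scaleC_right: "bounded_linear (\<lambda>x. c *\<^sub>C x :: 'b::complex_normed_vector)"
  by (rule bounded_linear_intro[where K = "cmod c"])
     (simp_all add: scaleC_add_right scaleR_scaleC scaleC_scaleC norm_scaleC mult.commute)

lift_definition scaleC_bop :: "complex \<Rightarrow> 'a bop \<Rightarrow> 'a bop"
  is "\<lambda>c T. Blinfun (\<lambda>x. c *\<^sub>C blinfun_apply T x)"
  by (simp add: bounded_linear_Blinfun_apply scaleC_scaleC mult.commute
      bounded_linear_compose[OF bounded_linear_scaleC_right blinfun.bounded_linear_right])

definition dist_bop :: "'a bop \<Rightarrow> 'a bop \<Rightarrow> real" where
  "dist_bop S T = norm (S - T)"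
definition uniformity_bop :: "('a bop \<times> 'a bop) filter" where
  "uniformity_bop = (INF e\<in>{0 <..}. principal {(x, y). dist x y < e})"
definition open_bop :: "'a bop set \<Rightarrow> bool" where
  "open_bop S = (\<forall>x\<in>S. \<forall>\<^sub>F (x', y) in uniformity. x' = x \<longrightarrow> y \<in> S)"
definition sgn_bop :: "'a bop \<Rightarrow> 'a bop" where
  "sgn_bop T = inverse (norm T) *\<^sub>R T"

lemma bop_apply_scaleC_left: "bop_apply (c *\<^sub>C T) x = c *\<^sub>C bop_apply T x"
  by transfer (simp add: bounded_linear_Blinfun_apply
      bounded_linear_compose[OF bounded_linear_scaleC_right blinfun.bounded_linear_right])

lemma bop_apply_add_left: "bop_apply (S + T) x = bop_apply S x + bop_apply T x"
  by transfer (simp add: blinfun.add_left)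

lemma bop_apply_scaleR_left: "bop_apply (r *\<^sub>R T) x = r *\<^sub>R bop_apply T x"
  by transfer (simp add: blinfun.scaleR_left)

lemma norm_bop_apply: "norm (bop_apply T x) \<le> norm T * norm x"
  by transfer (rule norm_blinfun)

lemma norm_bop_bound:
  "0 \<le> b \<Longrightarrow> (\<And>x. norm (bop_apply T x) \<le> b * norm x) \<Longrightarrow> norm T \<le> b"
  by transfer (rule norm_blinfun_bound)

instance
proof
  fix r s :: real and c d :: complex and S T U :: "'a bop"
  show "S + T + U = S + (T + U)" "S + T = T + S" "0 + S = S" "- S + S = 0" "S - T = S + - T"
    by (transfer; simp)+
  show "r *\<^sub>R (S + T) = r *\<^sub>R S + r *\<^sub>R T" "(r + s) *\<^sub>R T = r *\<^sub>R T + s *\<^sub>R T"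
    "r *\<^sub>R s *\<^sub>R T = (r * s) *\<^sub>R T" "1 *\<^sub>R T = T"
    by (transfer; simp add: scaleR_add_right scaleR_add_left)+
  show "c *\<^sub>C (S + T) = c *\<^sub>C S + c *\<^sub>C T" "(c + d) *\<^sub>C T = c *\<^sub>C T + d *\<^sub>C T"
    "c *\<^sub>C d *\<^sub>C T = (c * d) *\<^sub>C T" "1 *\<^sub>C T = T" "r *\<^sub>R T = complex_of_real r *\<^sub>C T"
    by (rule bop_eqI; simp add: bop_apply_scaleC_left bop_apply_add_left bop_apply_scaleR_left
        scaleC_add_right scaleC_add_left scaleC_scaleC scaleC_one scaleR_scaleC)+
  show "dist S T = norm (S - T)" "sgn T = inverse (norm T) *\<^sub>R T"
    by (simp_all add: dist_bop_def sgn_bop_def)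
  show "uniformity = (INF e\<in>{0 <..}. principal {(x, y :: 'a bop). dist x y < e})"
    by (rule uniformity_bop_def)
  show "open X = (\<forall>x\<in>X. \<forall>\<^sub>F (x', y) in uniformity. x' = x \<longrightarrow> y \<in> X)" for X :: "'a bop set"
    by (rule open_bop_def)
  show "norm T = 0 \<longleftrightarrow> T = 0" by transfer simp
  show "norm (S + T) \<le> norm S + norm T" by transfer (rule norm_triangle_ineq)
  show "norm (r *\<^sub>R T) = \<bar>r\<bar> * norm T" by transfer simp
  have le: "norm (e *\<^sub>C V) \<le> cmod e * norm V" for e and V :: "'a bop"
  proof (rule norm_bop_bound)
    have "0 \<le> norm V" by transfer simp
    then show "0 \<le> cmod e * norm V" by simp
    show "norm (bop_apply (e *\<^sub>C V) x) \<le> cmod e * norm V * norm x" for x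
      using norm_bop_apply[of V x] by (simp add: bop_apply_scaleC_left norm_scaleC
          mult.assoc mult_left_mono)
  qed
  show "norm (c *\<^sub>C T) = cmod c * norm T"
  proof (cases "c = 0")
    case True
    moreover have "0 \<le> norm (0 *\<^sub>C T)" by transfer simp
    ultimately show ?thesis using le[of 0 T] by simp
  next
    case False
    have "T = inverse c *\<^sub>C c *\<^sub>C T"
      using False by (intro bop_eqI) (simp add: bop_apply_scaleC_left scaleC_scaleC scaleC_one)
    then have "norm T \<le> cmod (inverse c) * norm (c *\<^sub>C T)"
      using le[of "inverse c" "c *\<^sub>C T"] by simp
    then have "cmod c * norm T \<le> cmod c * (cmod (inverse c) * norm (c *\<^sub>C T))"
      by (rule mult_left_mono) simp
    also have "\<dots> = norm (c *\<^sub>C T)"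
      using False by (simp add: mult.assoc[symmetric] norm_mult[symmetric])
    finally have "cmod c * norm T \<le> norm (c *\<^sub>C T)" .
    with le[of c T] show ?thesis by simp
  qed
qed

end

lemma bop_apply_diff_left: "bop_apply (S - T) x = bop_apply S x - bop_apply T x"
  by transfer (simp add: blinfun.diff_left)

lemma bop_exists_adjoint:
  fixes T :: "'a::chilbert_space bop"
  shows "\<exists>S. \<forall>x y. cinner (bop_apply T x) y = cinner x (bop_apply S y)"
proof -
  interpret T: bounded_linear "bop_apply T" by (rule bounded_linear_bop_apply)
  have "\<exists>z. \<forall>x. inner (bop_apply T x) y = inner x z" for y
    by (rule riesz_representation_real)
       (intro bounded_linear_compose[OF bounded_linear_inner_left T.bounded_linear_axioms])
  then obtain g where g: "\<And>x y. inner (bop_apply T x) y = inner x (g y)" by metis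
  have adj: "cinner (bop_apply T x) y = cinner x (g y)" for x y
  proof (rule complex_eqI)
    show "Re (cinner (bop_apply T x) y) = Re (cinner x (g y))"
      by (simp add: Re_cinner g)
    show "Im (cinner (bop_apply T x) y) = Im (cinner x (g y))"
      unfolding Im_cinner by (metis g bop_apply_scaleC)
  qed
  have g_add: "g (y + z) = g y + g z" for y z
    by (rule cinner_extensionality) (simp add: adj[symmetric] cinner_add_right)
  have g_scale: "g (c *\<^sub>C y) = c *\<^sub>C g y" for c y
    by (rule cinner_extensionality) (simp add: adj[symmetric] cinner_scaleC_right)
  have "norm (g y) \<le> norm y * norm T" for y
  proof (cases "g y = 0")
    case False
    have "norm (g y) * norm (g y) = inner (bop_apply T (g y)) y"
      by (simp add: g power2_norm_eq_inner[symmetric] power2_eq_square)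
    also have "\<dots> \<le> norm (bop_apply T (g y)) * norm y"
      by (rule norm_cauchy_schwarz)
    also have "\<dots> \<le> norm T * norm (g y) * norm y"
      by (intro mult_right_mono norm_bop_apply) simp
    finally show ?thesis using False by (simp add: mult.commute mult.left_commute)
  qed simp
  then have bl: "bounded_linear g"
    by (intro bounded_linear_intro[where K = "norm T"]) (simp_all add: g_add g_scale scaleR_scaleC)
  have "bop_apply (Bop (Blinfun g)) = g"
    by (simp add: bop_apply.rep_eq Bop_inverse bounded_linear_Blinfun_apply[OF bl] g_scale)
  with adj show ?thesis by metis
qed

instantiation bop :: (chilbert_space) cstar_algebra
begin

lift_definition times_bop :: "'a bop \<Rightarrow> 'a bop \<Rightarrow> 'a bop" is "(o\<^sub>L)"
  by simp

definition star_bop :: "'a bop \<Rightarrow> 'a bop" where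
  "star_bop T = (THE S. \<forall>x y. cinner (bop_apply T x) y = cinner x (bop_apply S y))"

lemma bop_apply_mult: "bop_apply (S * T) x = bop_apply S (bop_apply T x)"
  by transfer simp

lemma cinner_star_right: "cinner x (bop_apply (star T) y) = cinner (bop_apply T x) y"
proof -
  have "\<exists>!S. \<forall>x y. cinner (bop_apply T x) y = cinner x (bop_apply S y)"
    by (rule ex_ex1I[OF bop_exists_adjoint])
       (rule bop_eqI, rule cinner_extensionality, metis)
  then have "\<forall>x y. cinner (bop_apply T x) y = cinner x (bop_apply (star T) y)"
    unfolding star_bop_def by (rule theI')
  then show ?thesis by metis
qed

lemma star_bop_eqI:
  "(\<And>x y. cinner (bop_apply T x) y = cinner x (bop_apply S y)) \<Longrightarrow> star T = S"
  by (rule bop_eqI, rule cinner_extensionality) (simp add: cinner_star_right)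

lemma cinner_star_left: "cinner (bop_apply (star T) x) y = cinner x (bop_apply T y)"
  by (metis cinner_commute cinner_star_right)

instance
proof
  fix r :: real and c :: complex and S T U :: "'a bop"
  interpret S: bounded_linear "bop_apply S" by (rule bounded_linear_bop_apply)
  show "S * T * U = S * (T * U)"
    by (rule bop_eqI) (simp add: bop_apply_mult)
  show "(S + T) * U = S * U + T * U" "S * (T + U) = S * T + S * U"
    by (rule bop_eqI; simp add: bop_apply_mult bop_apply_add_left S.add)+
  show "r *\<^sub>R S * T = r *\<^sub>R (S * T)" "S * r *\<^sub>R T = r *\<^sub>R (S * T)"
    by (rule bop_eqI; simp add: bop_apply_mult bop_apply_scaleR_left S.scaleR)+
  show "c *\<^sub>C S * T = c *\<^sub>C (S * T)" "S * c *\<^sub>C T = c *\<^sub>C (S * T)"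
    by (rule bop_eqI; simp add: bop_apply_mult bop_apply_scaleC_left bop_apply_scaleC)+
  show mult: "norm (S * T) \<le> norm S * norm T" for S T :: "'a bop"
    by transfer (rule norm_blinfun_compose)
  show "star (S + T) = star S + star T" "star (c *\<^sub>C S) = cnj c *\<^sub>C star S"
    "star (S * T) = star T * star S" "star (star S) = S"
    by (rule star_bop_eqI; simp add: bop_apply_add_left bop_apply_scaleC_left bop_apply_mult
        cinner_add_left cinner_add_right cinner_scaleC_left cinner_scaleC_right
        cinner_star_left cinner_star_right)+
  have sq: "(norm V)\<^sup>2 \<le> norm (star V * V)" for V :: "'a bop"
  proof -
    have "norm (bop_apply V x) \<le> sqrt (norm (star V * V)) * norm x" for x
    proof (rule power2_le_imp_le)
      have "(norm (bop_apply V x))\<^sup>2 = inner x (bop_apply (star V * V) x)"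
        by (simp add: power2_norm_eq_inner Re_cinner[symmetric] bop_apply_mult cinner_star_right)
      also have "\<dots> \<le> norm x * norm (bop_apply (star V * V) x)"
        by (rule norm_cauchy_schwarz)
      also have "\<dots> \<le> norm x * (norm (star V * V) * norm x)"
        by (intro mult_left_mono norm_bop_apply) simp
      finally show "(norm (bop_apply V x))\<^sup>2 \<le> (sqrt (norm (star V * V)) * norm x)\<^sup>2"
        by (simp add: power_mult_distrib power2_eq_square mult_ac)
    qed simp
    then have "norm V \<le> sqrt (norm (star V * V))"
      by (intro norm_bop_bound) auto
    then have "(norm V)\<^sup>2 \<le> (sqrt (norm (star V * V)))\<^sup>2"
      by (rule power_mono) (transfer, simp)
    then show ?thesis by simp
  qed
  have star_le: "norm V \<le> norm (star V)" for V :: "'a bop"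
  proof (cases "V = 0")
    case False
    have "norm V * norm V \<le> norm (star V) * norm V"
      using order_trans[OF sq mult] by (simp add: power2_eq_square)
    then show ?thesis using False by simp
  qed simp
  have "star (star S) = S"
    by (rule star_bop_eqI) (simp add: cinner_star_left)
  then have "norm (star S) = norm S"
    using star_le[of S] star_le[of "star S"] by simp
  then show "norm (star S * S) = (norm S)\<^sup>2"
    using sq[of S] mult[of "star S" S] by (simp add: power2_eq_square)
next
  fix X :: "nat \<Rightarrow> 'a bop"
  assume "Cauchy X"
  have dist_rep: "dist S T = dist (blinfun_of_bop S) (blinfun_of_bop T)" for S T :: "'a bop"
    by (simp add: dist_norm norm_bop.rep_eq minus_bop.rep_eq)
  with \<open>Cauchy X\<close> have "Cauchy (\<lambda>n. blinfun_of_bop (X n))"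
    by (simp add: Cauchy_def)
  then obtain L where L: "(\<lambda>n. blinfun_of_bop (X n)) \<longlonglongrightarrow> L"
    using Cauchy_convergent convergent_def by blast
  have ptw: "(\<lambda>n. bop_apply (X n) x) \<longlonglongrightarrow> blinfun_apply L x" for x
    unfolding bop_apply.rep_eq by (intro blinfun.tendsto L tendsto_const)
  have "blinfun_apply L (c *\<^sub>C x) = c *\<^sub>C blinfun_apply L x" for c x
    using LIMSEQ_unique[OF ptw[of "c *\<^sub>C x", unfolded bop_apply_scaleC]
      bounded_linear.tendsto[OF bounded_linear_scaleC_right ptw[of x]]] .
  then have "blinfun_of_bop (Bop L) = L" by (simp add: Bop_inverse)
  with L have "X \<longlonglongrightarrow> Bop L"
    unfolding tendsto_iff dist_rep by simp
  then show "convergent X" by (auto simp: convergent_def)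
qed

end

end

theory Submission
  imports Defs
begin

text \<open>A normalizer \<open>n\<close> of an abelian algebra \<open>D\<close> acts like a partial map on the spectrum of \<open>D\<close>: if
  \<open>r 0, r 1, \<dots>\<close> are orthogonal projections in \<open>D\<close>, then below every nonzero \<open>p \<in> D\<close> there is a nonzero
  \<open>p * d \<in> D\<close>, so small that \<open>n\<close> carries it into a single \<open>r k\<close> (\<open>normalizer_localizes\<close>). Hence a
  linear combination \<open>x\<close> of \<open>N\<close> normalizers carries some small piece of any given nonzero element of
  \<open>D\<close> into at most \<open>N\<close> of the \<open>r k\<close> (\<open>span_normalizers_localizes\<close>), up to the complement of all of
  them. An operator that spreads every vector of some \<open>r m H\<close> thinly over many \<open>r k\<close> therefore stays
  at a fixed distance from every such \<open>x\<close>, and the span of the normalizers is not dense.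

  The operator is \<open>b \<xi> = (\<Sum>k. \<langle>\<xi>, a k\<rangle> f k)\<close>, where \<open>f k\<close> is a unit vector in \<open>r k H\<close> and the vectors
  \<open>a k\<close> form a tight frame of the sum of the spaces \<open>r m H\<close> in which those belonging to \<open>r m\<close> have norm
  at most \<open>1 / sqrt (m + 1)\<close>. Each coefficient of \<open>\<xi> \<in> r m H\<close> then carries at most the fraction
  \<open>1 / (m + 1)\<close> of the mass of \<open>\<xi>\<close>, so that removing \<open>N\<close> of the \<open>r k\<close> loses at most half of it as soon
  as \<open>2 * N \<le> m + 1\<close> (\<open>ex_spreading_operator\<close>). Such frames come from a countable orthonormal
  basis, which is where separability enters. The inequality only involves elements of the form
  \<open>R * b * c\<close> with \<open>R, c \<in> D\<close>, which lie in the bounded operators, so it does not matter how much larger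
  the ambient algebra is.

  Infinitely many orthogonal projections exist in \<open>D\<close> because a MASA of bounded operators contains
  every self-adjoint operator commuting with it (\<open>masa_contains_commuting_selfadjoint\<close>), in
  particular the spectral projections of its elements (\<open>ex_spectral_projection\<close>). An infinite-rank
  projection in \<open>D\<close> on which \<open>D\<close> acted by scalars would commute with rank-one operators inside it and
  force these into \<open>D\<close>; so it can always be split, and one of the two halves has infinite rank again
  (\<open>masa_split_infinite_rank\<close>).\<close>

section \<open>C*-algebra preliminaries\<close>

lemma norm_star: "norm (star x) = norm x" for x :: "'a::cstar_algebra"
proof -
  have le: "norm y \<le> norm (star y)" for y :: 'a
  proof (cases "y = 0")
    case False
    have "norm y * norm y \<le> norm (star y) * norm y"
      using cstar_identity[of y] norm_mult_ineq[of "star y" y] by (simp add: power2_eq_square)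
    with False show ?thesis by simp
  qed simp
  from le[of x] le[of "star x"] show ?thesis by (simp add: star_star)
qed

lemma bounded_linear_star: "bounded_linear (star :: 'a::cstar_algebra \<Rightarrow> 'a)"
  by (rule bounded_linear_intro[where K = 1])
    (simp_all add: star_add scaleR_scaleC star_scaleC norm_star)

lemmas star_zero = linear_0[OF bounded_linear.linear[OF bounded_linear_star]]
  and star_diff = linear_diff[OF bounded_linear.linear[OF bounded_linear_star]]
  and star_sum = linear_sum[OF bounded_linear.linear[OF bounded_linear_star]]

lemma star_mult_self_eq_0_iff: "star x * x = 0 \<longleftrightarrow> x = 0" for x :: "'a::cstar_algebra"
  using cstar_identity[of x] by auto

definition projection :: "'a::cstar_algebra \<Rightarrow> bool" where
  "projection p \<longleftrightarrow> star p = p \<and> p * p = p"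

lemma norm_projection_le_1: "projection p \<Longrightarrow> norm p \<le> 1"
  using cstar_identity[of p]
  by (cases "p = 0") (auto simp: projection_def power2_eq_square)

text \<open>In unital terms \<open>(1 - y)\<^sup>2 = 1 - x\<close>, so \<open>1 - y\<close> is a square root of \<open>1 - x\<close>; the equation is
  written so as to make sense without a unit. The root is the limit of the iteration
  \<open>y \<mapsto> (x + y\<^sup>2) / 2\<close> from \<open>0\<close>. Its increments are dominated by those of the same iteration on
  real numbers with \<open>x\<close> replaced by \<open>1\<close>, which increases and stays below \<open>1\<close>.\<close>

lemma ex_root_of_one_minus:
  fixes x :: "'a::cstar_algebra"
  assumes "star x = x" and "norm x \<le> 1"
  obtains y where "star y = y" "norm y \<le> 1" "2 *\<^sub>R y = x + y * y"
    "\<And>z. z * x = x * z \<Longrightarrow> z * y = y * z"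
proof -
  define Y where "Y = rec_nat (0::'a) (\<lambda>_ y. (1/2) *\<^sub>R (x + y * y))"
  \<comment> \<open>The scalar majorant of the iteration.\<close>
  define t where "t = rec_nat (0::real) (\<lambda>_ s. (1 + s * s) / 2)"
  have Y0: "Y 0 = 0" and YS: "Y (Suc n) = (1/2) *\<^sub>R (x + Y n * Y n)" for n
    by (simp_all add: Y_def)
  have t0: "t 0 = 0" and tS: "t (Suc n) = (1 + t n * t n) / 2" for n
    by (simp_all add: t_def)
  have comm: "z * Y n = Y n * z" if "z * x = x * z" for z n
  proof (induction n)
    case (Suc n)
    have "z * (Y n * Y n) = Y n * Y n * z" by (metis Suc.IH mult.assoc)
    then show ?case by (simp add: YS distrib_left distrib_right that)
  qed (simp add: Y0)
  have commY: "Y m * Y n = Y n * Y m" for m n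
    by (rule comm) (rule comm[symmetric], simp)
  have sa: "star (Y n) = Y n" for n
    by (induction n) (simp_all add: Y0 YS star_zero scaleR_scaleC star_scaleC star_add star_mult assms)
  have t01: "0 \<le> t n \<and> t n \<le> 1" for n
  proof (induction n)
    case (Suc n)
    then have "t n * t n \<le> 1" by (simp add: mult_le_one)
    with Suc show ?case by (simp add: tS)
  qed (simp add: t0)
  have nY: "norm (Y n) \<le> t n" for n
  proof (induction n)
    case (Suc n)
    have "norm (Y n * Y n) \<le> t n * t n"
      by (rule order_trans[OF norm_mult_ineq mult_mono'[OF Suc Suc]]) simp_all
    then have "norm (x + Y n * Y n) \<le> 1 + t n * t n"
      using norm_triangle_ineq[of x "Y n * Y n"] assms(2) by linarith
    then show ?case by (simp add: YS tS)
  qed (simp add: Y0 t0)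
  have step: "norm (Y (Suc n) - Y n) \<le> t (Suc n) - t n" for n
  proof (induction n)
    case 0
    show ?case using nY[of "Suc 0"] by (simp add: Y0 t0)
  next
    case (Suc n)
    have "Y (Suc (Suc n)) - Y (Suc n) = (1/2) *\<^sub>R ((Y (Suc n) - Y n) * (Y (Suc n) + Y n))"
      using commY[of n "Suc n"] unfolding YS[of "Suc n"] YS[of n, symmetric] 
      by (subst (3) YS) (simp add: algebra_simps flip: scaleR_diff_right)
    also have "norm \<dots> \<le> (1/2) * ((t (Suc n) - t n) * (t (Suc n) + t n))"
      using mult_mono'[OF Suc order_trans[OF norm_triangle_ineq add_mono[OF nY nY]]]
      by (simp add: order_trans[OF norm_mult_ineq])
    also have "\<dots> = t (Suc (Suc n)) - t (Suc n)"
      by (subst (3) tS, subst (5) tS) (simp add: algebra_simps diff_divide_distrib)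
    finally show ?case .
  qed
  have mono: "t n \<le> t (Suc n)" for n
    using step[of n] norm_ge_zero[of "Y (Suc n) - Y n"] by linarith
  have inc: "incseq t" by (rule incseq_SucI) (rule mono)
  have "convergent t"
  proof (rule Bseq_mono_convergent)
    show "Bseq t" by (rule BseqI'[of _ 1]) (use t01 in auto)
    show "\<forall>m. \<forall>n\<ge>m. t m \<le> t n" using inc by (auto dest: incseqD)
  qed
  then have tC: "Cauchy t" by (rule convergent_Cauchy)
  have gap: "norm (Y (n + k) - Y n) \<le> t (n + k) - t n" for n k
  proof (induction k)
    case (Suc k)
    have "Y (n + Suc k) - Y n = (Y (Suc (n + k)) - Y (n + k)) + (Y (n + k) - Y n)" by simp
    then have "norm (Y (n + Suc k) - Y n) \<le> norm (Y (Suc (n + k)) - Y (n + k)) + norm (Y (n + k) - Y n)"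
      by (metis norm_triangle_ineq)
    with step[of "n + k"] Suc show ?case by simp
  qed simp
  have "Cauchy Y"
  proof (rule metric_CauchyI)
    fix r :: real assume "r > 0"
    then obtain M where M: "\<And>m n. m \<ge> M \<Longrightarrow> n \<ge> M \<Longrightarrow> dist (t m) (t n) < r"
      using metric_CauchyD[OF tC] by blast
    have le: "dist (Y m) (Y n) < r" if "n \<ge> M" "m \<ge> n" for m n
      using gap[of n "m - n"] M[of m n] that by (auto simp: dist_norm)
    have "dist (Y m) (Y n) < r" if "n \<ge> M" "m \<ge> M" for m n
      using le[of m n] le[of n m] that by (metis dist_commute nle_le)
    then show "\<exists>M. \<forall>m\<ge>M. \<forall>n\<ge>M. dist (Y m) (Y n) < r" by blast
  qed
  then obtain y where y: "Y \<longlonglongrightarrow> y" by (auto simp: Cauchy_convergent_iff convergent_def)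
  show thesis
  proof
    show "star y = y"
      using LIMSEQ_unique[OF bounded_linear.tendsto[OF bounded_linear_star y, unfolded sa] y] .
    show "norm y \<le> 1"
      by (rule LIMSEQ_le_const2[OF tendsto_norm[OF y]]) (use nY t01 in \<open>meson order_trans\<close>)
    have "(\<lambda>n. (1/2) *\<^sub>R (x + Y n * Y n)) \<longlonglongrightarrow> (1/2) *\<^sub>R (x + y * y)"
      by (intro tendsto_intros y)
    with LIMSEQ_Suc[OF y] have "y = (1/2) *\<^sub>R (x + y * y)"
      unfolding YS by (rule LIMSEQ_unique)
    then show "2 *\<^sub>R y = x + y * y" by (metis scaleR_half_double scaleR_2 scaleR_right_distrib)
    show "z * y = y * z" if "z * x = x * z" for z
      using LIMSEQ_unique[OF tendsto_mult_left[OF y, of z, unfolded comm[OF that]] tendsto_mult_right[OF y, of z]] .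
  qed
qed

text \<open>The bicommutant of \<open>D\<close> together with \<open>s\<close> is an abelian *-algebra containing \<open>D\<close>, so maximality
  makes it equal to \<open>D\<close>.\<close>

lemma masa_contains_commuting_selfadjoint:
  assumes D: "masa D" and s: "star s = s" and comm: "\<And>d. d \<in> D \<Longrightarrow> s * d = d * s"
  shows "s \<in> D"
proof -
  define C where "C = {y. \<forall>z\<in>insert s D. y * z = z * y}"
  define A where "A = {x. \<forall>y\<in>C. x * y = y * x}"
  have Dab: "abelian D" and Dst: "star_subalgebra D" using D by (auto simp: masa_def)
  have XC: "insert s D \<subseteq> C" and XA: "insert s D \<subseteq> A"
    using comm Dab by (auto simp: C_def A_def abelian_def)
  have stC: "star y \<in> C" if "y \<in> C" for y
  proof -
    have "star y * z = z * star y" if "z \<in> insert s D" for z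
    proof -
      have "star z \<in> insert s D" using that Dst s by (auto simp: star_subalgebra_def)
      then have "y * star z = star z * y" using \<open>y \<in> C\<close> unfolding C_def by blast
      then show ?thesis by (metis star_mult star_star)
    qed
    then show ?thesis by (simp add: C_def)
  qed
  have stA: "star x \<in> A" if "x \<in> A" for x
  proof -
    have "star x * y = y * star x" if "y \<in> C" for y
    proof -
      have "x * star y = star y * x" using \<open>x \<in> A\<close> stC[OF that] by (simp add: A_def)
      then show ?thesis by (metis star_mult star_star)
    qed
    then show ?thesis by (simp add: A_def)
  qed
  have "x * y * c = c * (x * y)" if "x \<in> A" "y \<in> A" "c \<in> C" for x y c
    using that unfolding A_def by (metis (mono_tags, lifting) mem_Collect_eq mult.assoc)
  then have mA: "x * y \<in> A" if "x \<in> A" "y \<in> A" for x y using that by (simp add: A_def)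
  have "csubspace A"
    by (rule complex_vector.subspaceI)
      (auto simp: A_def distrib_left distrib_right mult_scaleC_left mult_scaleC_right)
  then have "star_subalgebra A" using stA mA by (simp add: star_subalgebra_def)
  moreover have "abelian A"
  proof -
    have "A \<subseteq> C" using XC unfolding A_def C_def by blast
    then show ?thesis unfolding abelian_def A_def by blast
  qed
  ultimately have "A = D" using D XA by (auto simp: masa_def)
  with XA show ?thesis by auto
qed

text \<open>Decompose \<open>d\<close> into its real and imaginary parts.\<close>

lemma commutes_if_commutes_selfadjoint:
  assumes D: "star_subalgebra D" and comm: "\<And>a. a \<in> D \<Longrightarrow> star a = a \<Longrightarrow> s * a = a * s"
    and d: "d \<in> D"
  shows "s * d = d * s"
proof -
  have sub: "csubspace D" and st: "star d \<in> D" using D d by (auto simp: star_subalgebra_def)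
  define a where "a = d + star d"
  define b where "b = \<i> *\<^sub>C (d - star d)"
  have "a \<in> D" "b \<in> D" unfolding a_def b_def
    using sub st d by (auto intro: complex_vector.subspace_add complex_vector.subspace_diff complex_vector.subspace_scale)
  moreover have "star a = a" by (simp add: a_def star_add star_star add.commute)
  moreover have "star b = b"
    by (simp add: b_def star_scaleC star_diff star_star complex_vector.scale_right_diff_distrib)
  ultimately have ab: "s * a = a * s" "s * b = b * s" using comm by auto
  have d_eq: "d = (1/2) *\<^sub>C (a - \<i> *\<^sub>C b)"
  proof -
    have "a - \<i> *\<^sub>C b = d + d" by (simp add: a_def b_def scaleC_scaleC scaleC_one)
    also have "\<dots> = 2 *\<^sub>C d" using scaleC_add_left[of 1 1 d] by (simp add: scaleC_one)
    finally show ?thesis by (simp add: scaleC_scaleC scaleC_one)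
  qed
  show ?thesis unfolding d_eq
    by (simp add: mult_scaleC_left mult_scaleC_right right_diff_distrib left_diff_distrib ab)
qed

section \<open>The complex inner product\<close>

lemma cmod_cinner_le: "cmod (cinner x y) \<le> norm x * norm y" for x :: "'a::complex_inner"
proof (cases "cinner x y = 0")
  case False
  define u where "u = cnj (cinner x y) / cmod (cinner x y)"
  have "cmod u = 1" using False by (simp add: u_def norm_divide)
  have "u * cinner x y = of_real (cmod (cinner x y))"
    using False by (simp add: u_def complex_norm_square[symmetric] mult.commute[of "cnj _"] power2_eq_square)
  then have "cmod (cinner x y) = inner (u *\<^sub>C x) y"
    by (metis Re_cinner Re_complex_of_real cinner_scaleC_left)
  also have "\<dots> \<le> norm (u *\<^sub>C x) * norm y" by (rule norm_cauchy_schwarz)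
  finally show ?thesis by (simp add: norm_scaleC \<open>cmod u = 1\<close>)
qed simp

lemma bounded_linear_cinner_left: "bounded_linear (\<lambda>x. cinner x y)" for y :: "'a::complex_inner"
  by (rule bounded_linear_intro[where K = "norm y"])
    (simp_all add: cinner_add_left scaleR_scaleC cinner_scaleC_left cmod_cinner_le
      scaleR_conv_of_real)

lemmas cinner_zero_left = linear_0[OF bounded_linear.linear[OF bounded_linear_cinner_left]]
  and cinner_diff_left = linear_diff[OF bounded_linear.linear[OF bounded_linear_cinner_left]]
  and cinner_sum_left = linear_sum[OF bounded_linear.linear[OF bounded_linear_cinner_left]]
  and cinner_scaleR_left = linear_scale[OF bounded_linear.linear[OF bounded_linear_cinner_left]]

lemma cinner_zero_right: "cinner x 0 = 0" for x :: "'a::complex_inner"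
  using cinner_commute[of x 0] by (simp add: cinner_zero_left)

lemma cinner_self: "cinner x x = of_real ((norm x)\<^sup>2)" for x :: "'a::complex_inner"
proof (rule complex_eqI)
  show "Re (cinner x x) = Re (of_real ((norm x)\<^sup>2))" by (simp add: Re_cinner power2_norm_eq_inner)
  have "Im (cinner x x) = Im (cnj (cinner x x))" by (subst cinner_commute) (rule refl)
  then show "Im (cinner x x) = Im (of_real ((norm x)\<^sup>2))" by simp
qed

section \<open>Self-adjoint operators\<close>

text \<open>The form in which operators are built from explicit formulas.\<close>

lemma ex_bop:
  fixes f :: "'a::complex_normed_vector \<Rightarrow> 'a"
  assumes add: "\<And>x y. f (x + y) = f x + f y" and scale: "\<And>c x. f (c *\<^sub>C x) = c *\<^sub>C f x"
    and bound: "\<And>x. norm (f x) \<le> norm x * K"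
  obtains T where "bop_apply T = f"
proof
  have "bounded_linear f"
    by (rule bounded_linear_intro[where K = K]) (simp_all add: add scale scaleR_scaleC bound)
  then show "bop_apply (Bop (Blinfun f)) = f"
    by (simp add: bop_apply.rep_eq Bop_inverse bounded_linear_Blinfun_apply scale)
qed

lift_definition id_bop :: "'a::complex_normed_vector bop" is id_blinfun
  by simp

lemma bop_apply_id [simp]: "bop_apply id_bop x = x"
  by transfer simp

lemma id_bop_mult [simp]: "id_bop * T = T" "T * id_bop = T" for T :: "'h::chilbert_space bop"
  by (rule bop_eqI; simp add: bop_apply_mult)+

lemma bop_apply_zero [simp]: "bop_apply 0 x = 0" "bop_apply T 0 = 0"
  by (simp_all add: zero_bop.rep_eq bop_apply.rep_eq)

lemmas bop_apply_add = linear_add[OF bounded_linear.linear[OF bounded_linear_bop_apply]]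
  and bop_apply_diff = linear_diff[OF bounded_linear.linear[OF bounded_linear_bop_apply]]
  and bop_apply_scaleR = linear_scale[OF bounded_linear.linear[OF bounded_linear_bop_apply]]

lemmas bop_simps = bop_apply_mult bop_apply_add_left bop_apply_diff_left bop_apply_scaleR_left
  bop_apply_scaleC_left bop_apply_add bop_apply_diff bop_apply_scaleR bop_apply_scaleC

text \<open>Symmetry for the real inner product is enough because the imaginary part of the complex one is a
  real inner product with \<open>- \<i> x\<close>. It allows all limits and estimates below to be done with \<open>inner\<close>.\<close>

lemma selfadjoint_iff:
  "star T = T \<longleftrightarrow> (\<forall>x y. inner (bop_apply T x) y = inner x (bop_apply T y))"
  for T :: "'h::chilbert_space bop"
proof
  show "\<forall>x y. inner (bop_apply T x) y = inner x (bop_apply T y)" if "star T = T"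
    using that by (metis Re_cinner cinner_star_right)
  assume *: "\<forall>x y. inner (bop_apply T x) y = inner x (bop_apply T y)"
  show "star T = T"
  proof (rule star_bop_eqI, rule complex_eqI)
    fix x y
    show "Re (cinner (bop_apply T x) y) = Re (cinner x (bop_apply T y))"
      by (simp add: Re_cinner *)
    show "Im (cinner (bop_apply T x) y) = Im (cinner x (bop_apply T y))"
      unfolding Im_cinner by (metis * bop_apply_scaleC)
  qed
qed

lemma star_id_bop [simp]: "star id_bop = (id_bop :: 'h::chilbert_space bop)"
  by (simp add: selfadjoint_iff)

lemma star_scaleR: "star (c *\<^sub>R x) = c *\<^sub>R star x" for x :: "'a::cstar_algebra"
  by (simp add: scaleR_scaleC star_scaleC)

lemma selfadjoint_eq_0:
  fixes T :: "'h::chilbert_space bop"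
  assumes sa: "star T = T" and form: "\<And>x. inner (bop_apply T x) x = 0"
  shows "T = 0"
proof (rule bop_eqI)
  fix x
  define y where "y = bop_apply T x"
  have "inner y y = inner x (bop_apply T y)" using sa by (simp add: y_def selfadjoint_iff)
  moreover have "inner (bop_apply T (x + y)) (x + y) = inner y y + inner (bop_apply T y) x"
    using form[of x] form[of y] by (simp add: bop_apply_add inner_add_left inner_add_right y_def)
  ultimately have "inner y y = 0" using form[of "x + y"] by (simp add: inner_commute)
  then show "bop_apply T x = bop_apply 0 x" by (simp add: y_def)
qed

text \<open>The even powers of \<open>t\<close> converge strongly: \<open>\<langle>t\<^sup>m x, t\<^sup>n x\<rangle>\<close> depends only on \<open>m + n\<close>, and \<open>\<parallel>t\<^sup>k x\<parallel>\<close>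
  decreases in \<open>k\<close>, so the distance of two even powers applied to \<open>x\<close> is controlled by a Cauchy
  sequence of reals. The limit is the projection onto the fixed space of \<open>t\<^sup>2\<close>; as a limit of powers
  it commutes with whatever commutes with \<open>t\<close>.\<close>

lemma ex_fixed_space_projection:
  fixes t :: "'h::chilbert_space bop"
  assumes sa: "star t = t" and le1: "norm t \<le> 1"
  obtains P where "projection P" "\<And>s. s * t = t * s \<Longrightarrow> s * P = P * s" "t * t * P = P"
    "\<And>x. bop_apply t x = x \<Longrightarrow> bop_apply P x = x"
proof -
  define a where "a n = bop_apply t ^^ n" for n
  have aS: "a (Suc n) x = bop_apply t (a n x)" for n x by (simp add: a_def)
  have a_add: "a (m + n) x = a m (a n x)" for m n x by (simp add: a_def funpow_add)
  have a_sym: "inner (a n x) y = inner x (a n y)" for n x y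
    using sa by (induction n arbitrary: x y) (simp_all add: a_def funpow_swap1 selfadjoint_iff)
  have a_inner: "inner (a m x) (a n x) = (norm (a k x))\<^sup>2" if "m + n = 2 * k" for m n k x
    using that by (simp add: power2_norm_eq_inner a_sym[of _ x] flip: a_add mult_2)
  have a_lin: "a n (x + y) = a n x + a n y" "a n (c *\<^sub>C x) = c *\<^sub>C a n x" for n x y c
    by (induction n) (simp_all add: a_def bop_simps)
  define N where "N x k = (norm (a k x))\<^sup>2" for x k
  have "norm (bop_apply t x) \<le> norm x" for x
    using norm_bop_apply[of t x] mult_right_mono[OF le1, of "norm x"] by simp
  then have decr: "norm (a (Suc k) x) \<le> norm (a k x)" for k x by (simp add: aS)
  have bound: "norm (a k x) \<le> norm x" for k x
  proof (induction k)
    case (Suc k) with decr[of k x] show ?case by linarith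
  qed (simp add: a_def)
  have NC: "Cauchy (N x)" for x
  proof -
    have "decseq (N x)"
      by (rule decseq_SucI) (simp add: N_def decr power_mono)
    moreover have "0 \<le> N x i" for i by (simp add: N_def)
    ultimately have "convergent (N x)"
      using decseq_convergent[of "N x" 0] convergent_def by metis
    then show ?thesis by (rule convergent_Cauchy)
  qed
  have gap: "(norm (a (2 * m) x - a (2 * n) x))\<^sup>2 = N x (2 * m) + N x (2 * n) - 2 * N x (m + n)" for x m n
    using a_inner[of "2 * m" "2 * n" "m + n" x]
    by (simp add: power2_norm_eq_inner N_def inner_diff_left inner_diff_right inner_commute)
  have "Cauchy (\<lambda>n. a (2 * n) x)" for x
  proof (rule metric_CauchyI)
    fix r :: real assume r: "r > 0"
    then obtain M where M: "\<And>m n. m \<ge> M \<Longrightarrow> n \<ge> M \<Longrightarrow> dist (N x m) (N x n) < r\<^sup>2 / 2"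
      using metric_CauchyD[OF NC[of x], of "r\<^sup>2 / 2"] by auto
    have "dist (a (2 * m) x) (a (2 * n) x) < r" if "m \<ge> M" "n \<ge> M" for m n
    proof -
      have "(norm (a (2 * m) x - a (2 * n) x))\<^sup>2 < r\<^sup>2"
        using M[of "2 * m" "m + n"] M[of "2 * n" "m + n"] that
        unfolding gap by (simp add: dist_real_def abs_if split: if_splits)
      then show ?thesis using r by (simp add: dist_norm power_less_imp_less_base)
    qed
    then show "\<exists>M. \<forall>m\<ge>M. \<forall>n\<ge>M. dist (a (2 * m) x) (a (2 * n) x) < r" by blast
  qed
  then have "\<exists>y. (\<lambda>n. a (2 * n) x) \<longlonglongrightarrow> y" for x
    by (auto simp: Cauchy_convergent_iff convergent_def)
  then obtain f where f: "\<And>x. (\<lambda>n. a (2 * n) x) \<longlonglongrightarrow> f x" by metis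
  obtain P where P: "bop_apply P = f"
  proof (rule ex_bop)
    show "f (x + y) = f x + f y" for x y
      by (rule LIMSEQ_unique[OF f]) (use tendsto_add[OF f[of x] f[of y]] in \<open>simp add: a_lin\<close>)
    show "f (c *\<^sub>C x) = c *\<^sub>C f x" for c x
      by (rule LIMSEQ_unique[OF f])
        (use bounded_linear.tendsto[OF bounded_linear_scaleC_right f[of x]] in \<open>simp add: a_lin\<close>)
    show "norm (f x) \<le> norm x * 1" for x
      by (rule LIMSEQ_le_const2[OF tendsto_norm[OF f]]) (simp add: bound)
  qed
  have ttf: "bop_apply t (bop_apply t (f x)) = f x" for x
  proof (rule LIMSEQ_unique)
    show "(\<lambda>n. bop_apply t (bop_apply t (a (2 * n) x))) \<longlonglongrightarrow> bop_apply t (bop_apply t (f x))"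
      by (intro bounded_linear.tendsto[OF bounded_linear_bop_apply] f)
    show "(\<lambda>n. bop_apply t (bop_apply t (a (2 * n) x))) \<longlonglongrightarrow> f x"
      using LIMSEQ_Suc[OF f[of x]] by (simp add: aS)
  qed
  have fixed: "f y = y" if "bop_apply t (bop_apply t y) = y" for y
  proof -
    have "a (2 * n) y = y" for n by (induction n) (simp_all add: a_def that)
    then show ?thesis using f[of y] by (simp add: LIMSEQ_const_iff)
  qed
  show thesis
  proof
    show "projection P"
      unfolding projection_def
    proof
      show "star P = P"
        unfolding selfadjoint_iff P
      proof (intro allI)
        fix x y
        show "inner (f x) y = inner x (f y)"
          by (rule LIMSEQ_unique[OF tendsto_inner[OF f tendsto_const]])
            (use tendsto_inner[OF tendsto_const f, of x y] in \<open>simp add: a_sym\<close>)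
      qed
      show "P * P = P" by (rule bop_eqI) (simp add: bop_apply_mult P fixed ttf)
    qed
    show "t * t * P = P" by (rule bop_eqI) (simp add: bop_apply_mult P ttf)
    show "bop_apply P x = x" if "bop_apply t x = x" for x using that fixed by (simp add: P)
    show "s * P = P * s" if "s * t = t * s" for s
    proof (rule bop_eqI)
      fix x
      have st: "bop_apply s (bop_apply t y) = bop_apply t (bop_apply s y)" for y
        using that by (metis bop_apply_mult)
      have "bop_apply s (a n x) = a n (bop_apply s x)" for n
        by (induction n) (simp_all add: a_def st)
      then have "bop_apply s (f x) = f (bop_apply s x)"
        using LIMSEQ_unique[OF bounded_linear.tendsto[OF bounded_linear_bop_apply f[of x], of s]]
          f[of "bop_apply s x"] by simp
      then show "bop_apply (s * P) x = bop_apply (P * s) x" by (simp add: bop_apply_mult P)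
    qed
  qed
qed

lemma norm_id_minus_square_le:
  fixes T :: "'h::chilbert_space bop"
  assumes sa: "star T = T" and le1: "norm T \<le> 1"
  shows "norm (id_bop - T * T) \<le> 1"
proof (rule norm_bop_bound)
  fix x
  have le: "norm (bop_apply T y) \<le> norm y" for y
    using norm_bop_apply[of T y] mult_right_mono[OF le1, of "norm y"] by simp
  define y where "y = bop_apply T x"
  have "inner x (bop_apply T y) = (norm y)\<^sup>2"
    using sa by (simp add: selfadjoint_iff y_def power2_norm_eq_inner)
  then have "(norm (x - bop_apply T y))\<^sup>2 = (norm x)\<^sup>2 - 2 * (norm y)\<^sup>2 + (norm (bop_apply T y))\<^sup>2"
    by (simp add: power2_norm_eq_inner inner_diff_left inner_diff_right inner_commute)
  also have "\<dots> \<le> (norm x)\<^sup>2"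
    using power_mono[OF le[of y] norm_ge_zero, of 2] zero_le_power2[of "norm y"] by linarith
  finally have "norm (x - bop_apply T y) \<le> norm x" by (rule power2_le_imp_le) simp
  then show "norm (bop_apply (id_bop - T * T) x) \<le> 1 * norm x" by (simp add: bop_simps y_def)
qed simp

text \<open>\<open>1 - T\<^sup>2\<close> is a contraction, so \<open>h = 1 - y\<close> with \<open>(1 - y)\<^sup>2 = T\<^sup>2\<close>; it is positive since \<open>\<parallel>y\<parallel> \<le> 1\<close>.\<close>

lemma ex_absolute_value:
  fixes T :: "'h::chilbert_space bop"
  assumes sa: "star T = T" and le1: "norm T \<le> 1"
  obtains h where "star h = h" "norm h \<le> 1" "h * h = T * T" "\<And>x. 0 \<le> inner (bop_apply h x) x"
    "\<And>s. s * T = T * s \<Longrightarrow> s * h = h * s"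
proof -
  have star_x: "star (id_bop - T * T) = id_bop - T * T"
    by (simp add: star_diff star_mult sa)
  obtain y where y: "star y = y" "norm y \<le> 1" "2 *\<^sub>R y = (id_bop - T * T) + y * y"
    "\<And>z. z * (id_bop - T * T) = (id_bop - T * T) * z \<Longrightarrow> z * y = y * z"
    using ex_root_of_one_minus[OF star_x norm_id_minus_square_le[OF sa le1]] by metis
  define h where "h = id_bop - y"
  have hh: "h * h = T * T"
    using y(3) by (simp add: h_def algebra_simps scaleR_2)
  show thesis
  proof
    show sah: "star h = h" by (simp add: h_def star_diff y)
    show "h * h = T * T" by (rule hh)
    have "(norm h)\<^sup>2 = (norm T)\<^sup>2"
      using cstar_identity[of h] cstar_identity[of T] hh sa sah by simp
    then show "norm h \<le> 1" using le1 by simp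
    show "0 \<le> inner (bop_apply h x) x" for x
    proof -
      have "inner (bop_apply y x) x \<le> norm (bop_apply y x) * norm x" by (rule norm_cauchy_schwarz)
      also have "\<dots> \<le> norm x * norm x"
        using order_trans[OF norm_bop_apply mult_right_mono[OF y(2)], of x] by (simp add: mult_right_mono)
      finally show ?thesis
        by (simp add: h_def bop_simps inner_diff_left power2_norm_eq_inner[symmetric] power2_eq_square)
    qed
    show "s * h = h * s" if "s * T = T * s" for s
    proof -
      have "s * (T * T) = T * T * s" by (metis that mult.assoc)
      then have "s * y = y * s" by (intro y(4)) (simp add: algebra_simps)
      then show ?thesis by (simp add: h_def algebra_simps)
    qed
  qed
qed

text \<open>With the absolute value \<open>h\<close> of \<open>T\<close>, the operators \<open>h - T\<close> and \<open>h + T\<close> annihilate each other. The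
  projection \<open>P\<close> onto the kernel of \<open>h - T\<close> is the fixed-space projection of \<open>1 - w\<^sup>2\<close> where \<open>w\<close> is
  \<open>h - T\<close> scaled to a contraction; then \<open>T = h\<close> on the range of \<open>P\<close> and \<open>T = - h\<close> on its complement.\<close>

lemma ex_spectral_projection_contraction:
  fixes T :: "'h::chilbert_space bop"
  assumes sa: "star T = T" and le1: "norm T \<le> 1"
  obtains P where "projection P" "\<And>s. s * T = T * s \<Longrightarrow> s * P = P * s"
    "\<And>x. bop_apply P x = x \<Longrightarrow> 0 \<le> inner (bop_apply T x) x"
    "\<And>x. bop_apply P x = 0 \<Longrightarrow> inner (bop_apply T x) x \<le> 0"
proof -
  obtain h where h: "star h = h" "norm h \<le> 1" "h * h = T * T" "\<And>x. 0 \<le> inner (bop_apply h x) x"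
    "\<And>s. s * T = T * s \<Longrightarrow> s * h = h * s"
    using ex_absolute_value[OF sa le1] by metis
  have hT: "T * h = h * T" by (rule h(5)) simp
  define w where "w = (1/2) *\<^sub>R (h - T)"
  define v where "v = h + T"
  define t where "t = id_bop - w * w"
  have w_sa: "star w = w" by (simp add: w_def star_scaleR star_diff h sa)
  have w_le: "norm w \<le> 1"
    using norm_triangle_ineq4[of h T] h(2) le1 by (simp add: w_def)
  have wv: "w * v = 0" by (simp add: w_def v_def algebra_simps h(3) hT)
  have comm_w: "s * w = w * s" if "s * T = T * s" for s
    using h(5)[OF that] that by (simp add: w_def algebra_simps)
  have comm_t: "s * t = t * s" if "s * T = T * s" for s
  proof -
    have "s * (w * w) = w * w * s" by (metis comm_w[OF that] mult.assoc)
    then show ?thesis by (simp add: t_def algebra_simps)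
  qed
  have "star t = t" by (simp add: t_def star_diff star_mult w_sa)
  moreover have "norm t \<le> 1" unfolding t_def by (rule norm_id_minus_square_le[OF w_sa w_le])
  ultimately obtain P where P: "projection P" "\<And>s. s * t = t * s \<Longrightarrow> s * P = P * s" "t * t * P = P"
    "\<And>x. bop_apply t x = x \<Longrightarrow> bop_apply P x = x"
    using ex_fixed_space_projection by metis
  have w0: "bop_apply w (bop_apply P x) = 0" for x
  proof -
    define y where "y = bop_apply P x"
    define z where "z = bop_apply w (bop_apply w y)"
    have "bop_apply t (bop_apply t y) = y" using P(3) by (metis bop_apply_mult y_def)
    \<comment> \<open>\<open>t\<^sup>2 y = y\<close> expands to \<open>w\<^sup>4 y = 2 w\<^sup>2 y\<close>, impossible for a contraction unless \<open>w\<^sup>2 y = 0\<close>.\<close>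
    then have "bop_apply w (bop_apply w z) = 2 *\<^sub>R z"
      by (simp add: t_def bop_simps z_def scaleR_2 algebra_simps)
    moreover have "norm (bop_apply w (bop_apply w z)) \<le> norm z"
    proof -
      have le: "norm (bop_apply w u) \<le> norm u" for u
        using norm_bop_apply[of w u] mult_right_mono[OF w_le, of "norm u"] by simp
      from le[of "bop_apply w z"] le[of z] show ?thesis by simp
    qed
    ultimately have "z = 0" by simp
    then have "inner (bop_apply w y) (bop_apply w y) = 0"
      using w_sa by (simp add: selfadjoint_iff z_def)
    then show ?thesis by (simp add: y_def)
  qed
  have "t * v = v" by (simp add: t_def left_diff_distrib mult.assoc wv)
  then have Pv: "P * v = v"
    by (intro bop_eqI) (metis P(4) bop_apply_mult)
  have "v * T = T * v" by (simp add: v_def algebra_simps hT)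
  then have vP: "v * P = v" using P(2)[OF comm_t] Pv by metis
  show thesis
  proof
    show "projection P" by (rule P)
    show "s * P = P * s" if "s * T = T * s" for s using P(2)[OF comm_t[OF that]] .
    show "0 \<le> inner (bop_apply T x) x" if "bop_apply P x = x" for x
    proof -
      have "bop_apply T x = bop_apply h x" using w0[of x] that by (simp add: w_def bop_simps)
      then show ?thesis using h(4) by simp
    qed
    show "inner (bop_apply T x) x \<le> 0" if "bop_apply P x = 0" for x
    proof -
      have "bop_apply v x = 0" by (metis vP that bop_apply_mult bop_apply_zero(2))
      then have "bop_apply T x = - bop_apply h x" by (simp add: v_def bop_simps eq_neg_iff_add_eq_0 add.commute)
      then show ?thesis using h(4)[of x] by simp
    qed
  qed
qed

lemma ex_spectral_projection:
  fixes T :: "'h::chilbert_space bop"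
  assumes sa: "star T = T"
  obtains P where "projection P" "\<And>s. s * T = T * s \<Longrightarrow> s * P = P * s"
    "\<And>x. bop_apply P x = x \<Longrightarrow> 0 \<le> inner (bop_apply T x) x"
    "\<And>x. bop_apply P x = 0 \<Longrightarrow> inner (bop_apply T x) x \<le> 0"
proof -
  define c where "c = 1 / (norm T + 1)"
  have c: "c > 0" by (simp add: c_def add_nonneg_pos)
  have "star (c *\<^sub>R T) = c *\<^sub>R T" by (simp add: star_scaleR sa)
  moreover have "norm (c *\<^sub>R T) \<le> 1" using c by (simp add: c_def)
  ultimately obtain P where P: "projection P" "\<And>s. s * c *\<^sub>R T = c *\<^sub>R T * s \<Longrightarrow> s * P = P * s"
    "\<And>x. bop_apply P x = x \<Longrightarrow> 0 \<le> inner (bop_apply (c *\<^sub>R T) x) x"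
    "\<And>x. bop_apply P x = 0 \<Longrightarrow> inner (bop_apply (c *\<^sub>R T) x) x \<le> 0"
    using ex_spectral_projection_contraction by metis
  show thesis
  proof
    show "projection P" by (rule P)
    show "s * P = P * s" if "s * T = T * s" for s by (rule P(2)) (simp add: that)
    show "0 \<le> inner (bop_apply T x) x" if "bop_apply P x = x" for x
      using P(3)[OF that] c by (simp add: bop_simps zero_le_mult_iff)
    show "inner (bop_apply T x) x \<le> 0" if "bop_apply P x = 0" for x
      using P(4)[OF that] c by (simp add: bop_simps mult_le_0_iff)
  qed
qed

section \<open>Projections in a MASA\<close>

lemma ex_rank_one:
  fixes \<xi> :: "'h::chilbert_space"
  obtains \<theta> where "star \<theta> = \<theta>" "\<And>x. bop_apply \<theta> x = cinner x \<xi> *\<^sub>C \<xi>"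
proof -
  obtain \<theta> where \<theta>: "bop_apply \<theta> = (\<lambda>x. cinner x \<xi> *\<^sub>C \<xi>)"
  proof (rule ex_bop)
    show "cinner (x + y) \<xi> *\<^sub>C \<xi> = cinner x \<xi> *\<^sub>C \<xi> + cinner y \<xi> *\<^sub>C \<xi>" for x y
      by (simp add: cinner_add_left scaleC_add_left)
    show "cinner (c *\<^sub>C x) \<xi> *\<^sub>C \<xi> = c *\<^sub>C cinner x \<xi> *\<^sub>C \<xi>" for c x
      by (simp add: cinner_scaleC_left scaleC_scaleC)
    show "norm (cinner x \<xi> *\<^sub>C \<xi>) \<le> norm x * (norm \<xi> * norm \<xi>)" for x
      using mult_right_mono[OF cmod_cinner_le[of x \<xi>], of "norm \<xi>"] by (simp add: norm_scaleC mult.assoc)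
  qed
  have "star \<theta> = \<theta>"
  proof (rule star_bop_eqI)
    fix x y
    have "cinner \<xi> y = cnj (cinner y \<xi>)" by (rule cinner_commute)
    then show "cinner (bop_apply \<theta> x) y = cinner x (bop_apply \<theta> y)"
      by (simp add: \<theta> cinner_scaleC_left cinner_scaleC_right)
  qed
  then show thesis using fun_cong[OF \<theta>] by (rule that)
qed

lemma id_bop_in_masa: "masa D \<Longrightarrow> id_bop \<in> D" for D :: "'h::chilbert_space bop set"
  by (rule masa_contains_commuting_selfadjoint) simp_all

text \<open>If every self-adjoint element of \<open>D\<close> acted on the range of \<open>r\<close> as a scalar, then \<open>D\<close> would commute
  with the rank-one projection (up to a factor) onto any vector \<open>\<xi>\<close> of that range. By maximality this
  operator belongs to \<open>D\<close>, hence acts on the range of \<open>r\<close> as a scalar too, and the range is spanned by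
  \<open>\<xi>\<close>.\<close>

lemma masa_projection_nonscalar:
  fixes D :: "'h::chilbert_space bop set"
  assumes D: "masa D" and r: "r \<in> D" "projection r"
    and big: "\<And>\<xi>. \<not> range (bop_apply r) \<subseteq> cspan {\<xi>}"
  obtains a where "a \<in> D" "star a = a" "\<And>c. a * r \<noteq> c *\<^sub>R r"
proof -
  have "\<exists>a. a \<in> D \<and> star a = a \<and> (\<forall>c. a * r \<noteq> c *\<^sub>R r)"
  proof (rule ccontr)
    assume "\<not> ?thesis"
    then have scalar: "\<exists>c. a * r = c *\<^sub>R r" if "a \<in> D" "star a = a" for a
      using that by blast
    have rr: "bop_apply r (bop_apply r x) = bop_apply r x" for x
      using r(2) by (metis projection_def bop_apply_mult)
    obtain \<xi> where \<xi>: "bop_apply r \<xi> = \<xi>" "\<xi> \<noteq> 0"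
    proof -
      have "\<not> range (bop_apply r) \<subseteq> {0}" using big[of 0] complex_vector.span_superset[of "{0}"] by (meson subset_trans)
      then obtain y where "bop_apply r y \<noteq> 0" by auto
      then show thesis using that[of "bop_apply r y"] rr by auto
    qed
    obtain \<theta> where \<theta>: "star \<theta> = \<theta>" "\<And>x. bop_apply \<theta> x = cinner x \<xi> *\<^sub>C \<xi>"
      using ex_rank_one[of \<xi>] by blast
    have "\<theta> * a = a * \<theta>" if a: "a \<in> D" "star a = a" for a
    proof (rule bop_eqI)
      fix x
      obtain c where "a * r = c *\<^sub>R r" using scalar[OF a] by blast
      then have "bop_apply (a * r) \<xi> = bop_apply (c *\<^sub>R r) \<xi>" by simp
      then have "bop_apply a \<xi> = c *\<^sub>R \<xi>" by (simp add: bop_simps \<xi>(1))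
      then have a\<xi>: "bop_apply a \<xi> = of_real c *\<^sub>C \<xi>" by (simp add: scaleR_scaleC)
      have "cinner (bop_apply a x) \<xi> = cinner x (bop_apply a \<xi>)"
        using cinner_star_right[of x a \<xi>] a(2) by simp
      then show "bop_apply (\<theta> * a) x = bop_apply (a * \<theta>) x"
        by (simp add: bop_apply_mult \<theta>(2) bop_apply_scaleC a\<xi> cinner_scaleC_right scaleC_scaleC mult.commute)
    qed
    then have "\<theta> * d = d * \<theta>" if "d \<in> D" for d
      using commutes_if_commutes_selfadjoint[of D \<theta> d] D that by (auto simp: masa_def)
    then have "\<theta> \<in> D" by (rule masa_contains_commuting_selfadjoint[OF D \<theta>(1)])
    then obtain c where c: "\<theta> * r = c *\<^sub>R r" using scalar \<theta>(1) by blast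
    have cx: "cinner (bop_apply r x) \<xi> *\<^sub>C \<xi> = c *\<^sub>R bop_apply r x" for x
      using arg_cong[OF c, of "\<lambda>T. bop_apply T x"] by (simp add: bop_simps \<theta>(2))
    have "c \<noteq> 0"
    proof
      assume "c = 0"
      then have "cinner \<xi> \<xi> = 0" using cx[of \<xi>] \<xi> by simp
      then have "inner \<xi> \<xi> = 0" by (metis Re_cinner zero_complex.sel(1))
      with \<xi> show False by simp
    qed
    have "bop_apply r x \<in> cspan {\<xi>}" for x
    proof -
      have "bop_apply r x = (1 / c) *\<^sub>R (c *\<^sub>R bop_apply r x)" using \<open>c \<noteq> 0\<close> by simp
      also have "\<dots> = (1 / c) *\<^sub>R (cinner (bop_apply r x) \<xi> *\<^sub>C \<xi>)"
        by (simp only: cx)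
      also have "\<dots> = of_real (1 / c) *\<^sub>C cinner (bop_apply r x) \<xi> *\<^sub>C \<xi>"
        by (rule scaleR_scaleC)
      also have "\<dots> \<in> cspan {\<xi>}"
        by (intro complex_vector.span_scale complex_vector.span_base) simp
      finally show ?thesis .
    qed
    with big[of \<xi>] show False by auto
  qed
  then show thesis using that by blast
qed

text \<open>Shift a self-adjoint \<open>a \<in> D\<close> that is not scalar on the range of \<open>r\<close> by a real number so that its
  quadratic form takes both signs there. The spectral projection of the shifted operator then cuts
  \<open>r\<close> properly.\<close>

lemma masa_projection_split:
  fixes D :: "'h::chilbert_space bop set"
  assumes D: "masa D" and r: "r \<in> D" "projection r"
    and big: "\<And>\<xi>. \<not> range (bop_apply r) \<subseteq> cspan {\<xi>}"
  obtains e where "e \<in> D" "projection e" "e * r = e" "r * e = e" "e \<noteq> 0" "e \<noteq> r"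
proof -
  have sub: "csubspace D" and mult: "\<And>x y. x \<in> D \<Longrightarrow> y \<in> D \<Longrightarrow> x * y \<in> D"
    and ab: "\<And>x y. x \<in> D \<Longrightarrow> y \<in> D \<Longrightarrow> x * y = y * x"
    using D by (auto simp: masa_def star_subalgebra_def abelian_def)
  have in_D: "a - c *\<^sub>R id_bop \<in> D" if "a \<in> D" for a c
    unfolding scaleR_scaleC using sub that id_bop_in_masa[OF D]
    by (intro complex_vector.subspace_diff complex_vector.subspace_scale) auto
  have rr: "bop_apply r (bop_apply r x) = bop_apply r x" for x
    using r(2) by (metis projection_def bop_apply_mult)
  have r_sa: "star r = r" using r(2) by (simp add: projection_def)
  obtain a where a: "a \<in> D" "star a = a" "\<And>c. a * r \<noteq> c *\<^sub>R r"
    using masa_projection_nonscalar[OF D r big] by metis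
  obtain \<xi> where \<xi>: "bop_apply r \<xi> = \<xi>" "\<xi> \<noteq> 0"
  proof -
    have "\<not> range (bop_apply r) \<subseteq> {0}" using big[of 0] complex_vector.span_superset[of "{0}"] by (meson subset_trans)
    then obtain y where "bop_apply r y \<noteq> 0" by auto
    then show thesis using that[of "bop_apply r y"] rr by auto
  qed
  define c where "c = inner (bop_apply a \<xi>) \<xi> / inner \<xi> \<xi>"
  define S where "S = a - c *\<^sub>R id_bop"
  have S: "S \<in> D" "star S = S" using in_D a by (auto simp: S_def star_diff star_scaleR)
  have S\<xi>: "inner (bop_apply S \<xi>) \<xi> = 0"
    using \<xi> by (simp add: S_def bop_simps inner_diff_left c_def)
  have "\<exists>\<eta>. bop_apply r \<eta> = \<eta> \<and> inner (bop_apply S \<eta>) \<eta> \<noteq> 0"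
  proof (rule ccontr)
    assume "\<not> ?thesis"
    then have zero: "inner (bop_apply S \<eta>) \<eta> = 0" if "bop_apply r \<eta> = \<eta>" for \<eta>
      using that by blast
    have comm: "S * r = r * S" using ab S r by blast
    have "S * r = 0"
    proof (rule selfadjoint_eq_0)
      show "star (S * r) = S * r" by (simp add: star_mult S r_sa comm)
      fix x
      have "inner (bop_apply (S * r) x) x = inner (bop_apply r (bop_apply S (bop_apply r x))) x"
        by (metis comm rr bop_apply_mult)
      also have "\<dots> = inner (bop_apply S (bop_apply r x)) (bop_apply r x)"
        using r_sa by (simp add: selfadjoint_iff)
      also have "\<dots> = 0" by (rule zero) (rule rr)
      finally show "inner (bop_apply (S * r) x) x = 0" .
    qed
    then have "a * r = c *\<^sub>R r" by (simp add: S_def left_diff_distrib)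
    with a(3) show False by blast
  qed
  then obtain \<eta> where \<eta>: "bop_apply r \<eta> = \<eta>" "inner (bop_apply S \<eta>) \<eta> \<noteq> 0" by blast
  have "\<eta> \<noteq> 0" using \<eta>(2) by auto
  \<comment> \<open>The form of \<open>S\<close> has value \<open>0\<close> at \<open>\<xi>\<close>; shifting by half its normalized value at \<open>\<eta>\<close>
    produces opposite signs at \<open>\<xi>\<close> and \<open>\<eta>\<close>.\<close>
  define \<mu> where "\<mu> = inner (bop_apply S \<eta>) \<eta> / (2 * inner \<eta> \<eta>)"
  define T where "T = S - \<mu> *\<^sub>R id_bop"
  have T: "T \<in> D" "star T = T" using in_D S by (auto simp: T_def star_diff star_scaleR)
  have T\<xi>: "inner (bop_apply T \<xi>) \<xi> = - \<mu> * inner \<xi> \<xi>"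
    by (simp add: T_def bop_simps inner_diff_left S\<xi>)
  have T\<eta>: "inner (bop_apply T \<eta>) \<eta> = \<mu> * inner \<eta> \<eta>"
    using \<open>\<eta> \<noteq> 0\<close> by (simp add: T_def bop_simps inner_diff_left \<mu>_def)
  have "\<mu> \<noteq> 0" using \<eta>(2) \<open>\<eta> \<noteq> 0\<close> by (simp add: \<mu>_def)
  have signs: "0 < - \<mu> * inner \<xi> \<xi> \<and> \<mu> * inner \<eta> \<eta> < 0 \<or> - \<mu> * inner \<xi> \<xi> < 0 \<and> 0 < \<mu> * inner \<eta> \<eta>"
    using \<open>\<mu> \<noteq> 0\<close> \<open>\<xi> \<noteq> 0\<close> \<open>\<eta> \<noteq> 0\<close> by (auto simp: zero_less_mult_iff mult_less_0_iff not_less le_less)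
  obtain P where P: "projection P" "\<And>s. s * T = T * s \<Longrightarrow> s * P = P * s"
    "\<And>x. bop_apply P x = x \<Longrightarrow> 0 \<le> inner (bop_apply T x) x"
    "\<And>x. bop_apply P x = 0 \<Longrightarrow> inner (bop_apply T x) x \<le> 0"
    using ex_spectral_projection[OF T(2)] by metis
  have PD: "P \<in> D"
  proof (rule masa_contains_commuting_selfadjoint[OF D])
    show "star P = P" using P(1) by (simp add: projection_def)
    show "P * d = d * P" if "d \<in> D" for d using P(2)[OF ab[OF that T(1)]] by (rule sym)
  qed
  have PP: "P * P = P" "star P = P" and rr': "r * r = r" using P(1) r by (auto simp: projection_def)
  have comm: "P * r = r * P" using ab PD r by blast
  show thesis
  proof
    show "P * r \<in> D" using mult PD r by blast
    show "projection (P * r)" unfolding projection_def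
      by (metis comm PP rr' r_sa star_mult mult.assoc)
    show "P * r * r = P * r" "r * (P * r) = P * r" by (metis comm rr' mult.assoc)+
    show "P * r \<noteq> 0"
    proof
      assume "P * r = 0"
      then have "bop_apply P x = 0" if "bop_apply r x = x" for x
        by (metis that bop_apply_mult bop_apply_zero(1))
      then have "bop_apply P \<xi> = 0" "bop_apply P \<eta> = 0" using \<xi> \<eta> by auto
      then show False using P(4) T\<xi> T\<eta> signs by fastforce
    qed
    show "P * r \<noteq> r"
    proof
      assume "P * r = r"
      then have "bop_apply P x = x" if "bop_apply r x = x" for x
        by (metis that bop_apply_mult)
      then have "bop_apply P \<xi> = \<xi>" "bop_apply P \<eta> = \<eta>" using \<xi> \<eta> by auto
      then show False using P(3) T\<xi> T\<eta> signs by fastforce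
    qed
  qed
qed

definition infinite_rank :: "'h::complex_normed_vector bop \<Rightarrow> bool" where
  "infinite_rank T \<longleftrightarrow> \<not> (\<exists>S. finite S \<and> range (bop_apply T) \<subseteq> cspan S)"

lemma masa_split_infinite_rank:
  fixes D :: "'h::chilbert_space bop set"
  assumes D: "masa D" and r: "r \<in> D" "projection r" "infinite_rank r"
  obtains e where "e \<in> D" "projection e" "e * r = e" "r * e = e" "e \<noteq> 0" "infinite_rank (r - e)"
proof -
  have "\<not> range (bop_apply r) \<subseteq> cspan {\<xi>}" for \<xi>
    using r(3) unfolding infinite_rank_def by (metis finite.emptyI finite_insert)
  then obtain e where e: "e \<in> D" "projection e" "e * r = e" "r * e = e" "e \<noteq> 0" "e \<noteq> r"
    using masa_projection_split[OF D r(1,2)] by metis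
  have "infinite_rank (r - e) \<or> infinite_rank e"
  proof (rule ccontr)
    assume "\<not> ?thesis"
    then obtain A B where AB: "finite A" "range (bop_apply (r - e)) \<subseteq> cspan A"
      "finite B" "range (bop_apply e) \<subseteq> cspan B" by (auto simp: infinite_rank_def)
    have "bop_apply r x \<in> cspan (A \<union> B)" for x
    proof -
      have "bop_apply r x = bop_apply (r - e) x + bop_apply e x" by (simp add: bop_simps)
      moreover have "bop_apply (r - e) x \<in> cspan (A \<union> B)"
        using AB(2) complex_vector.span_mono[of A "A \<union> B"] by auto
      moreover have "bop_apply e x \<in> cspan (A \<union> B)"
        using AB(4) complex_vector.span_mono[of B "A \<union> B"] by auto
      ultimately show ?thesis by (simp add: complex_vector.span_add)
    qed
    with AB(1,3) r(3) show False unfolding infinite_rank_def by (metis finite_UnI image_subsetI)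
  qed
  then show thesis
  proof
    assume "infinite_rank (r - e)"
    then show thesis using that e by blast
  next
    assume "infinite_rank e"
    show thesis
    proof (rule that[of "r - e"])
      show "r - e \<in> D"
        using D r(1) e(1) by (auto simp: masa_def star_subalgebra_def intro: complex_vector.subspace_diff)
      show "projection (r - e)"
        using r(2) e by (simp add: projection_def star_diff algebra_simps)
      show "(r - e) * r = r - e" "r * (r - e) = r - e"
        using r(2) e by (simp_all add: projection_def algebra_simps)
      show "r - e \<noteq> 0" using e by simp
      show "infinite_rank (r - (r - e))" using \<open>infinite_rank e\<close> by simp
    qed
  qed
qed

text \<open>Keep splitting: \<open>R n\<close> is what remains, of infinite rank, after the first \<open>n\<close> pieces \<open>g (R i)\<close> have
  been cut off.\<close>

lemma masa_infinite_orthogonal_projections: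
  fixes D :: "'h::chilbert_space bop set"
  assumes D: "masa D" and inf: "infinite_rank (id_bop :: 'h bop)"
  obtains r :: "nat \<Rightarrow> 'h bop"
  where "\<And>k. r k \<in> D" "\<And>k. projection (r k)" "\<And>k. r k \<noteq> 0" "\<And>j k. j \<noteq> k \<Longrightarrow> r j * r k = 0"
proof -
  define good where "good R \<longleftrightarrow> R \<in> D \<and> projection R \<and> infinite_rank R" for R
  have "\<exists>e. e \<in> D \<and> projection e \<and> e * R = e \<and> R * e = e \<and> e \<noteq> 0 \<and> infinite_rank (R - e)"
    if "good R" for R
  proof -
    have "R \<in> D" "projection R" "infinite_rank R" using that by (simp_all add: good_def)
    then show ?thesis by (rule masa_split_infinite_rank[OF D]) blast
  qed
  then have "\<exists>g. \<forall>R. good R \<longrightarrow> g R \<in> D \<and> projection (g R) \<and> g R * R = g R \<and> R * g R = g R \<and>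
      g R \<noteq> 0 \<and> infinite_rank (R - g R)"
    by (intro choice) blast
  then obtain g where g: "g R \<in> D" "projection (g R)" "g R * R = g R" "R * g R = g R" "g R \<noteq> 0"
    "infinite_rank (R - g R)" if "good R" for R by blast
  define R where "R = rec_nat (id_bop :: 'h bop) (\<lambda>_ R. R - g R)"
  have RS: "R (Suc n) = R n - g (R n)" for n by (simp add: R_def)
  have good_R: "good (R n)" for n
  proof (induction n)
    case 0
    show ?case using id_bop_in_masa[OF D] inf by (simp add: R_def good_def projection_def)
  next
    case (Suc n)
    note gn = g[OF Suc]
    have "projection (R (Suc n))"
      using gn Suc by (simp add: RS good_def projection_def star_diff algebra_simps)
    moreover have "R (Suc n) \<in> D"
      using D gn Suc by (auto simp: RS good_def masa_def star_subalgebra_def intro: complex_vector.subspace_diff)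
    ultimately show ?case using gn by (simp add: good_def RS)
  qed
  note gR = g[OF good_R]
  have RR: "R n * R n = R n" for n using good_R[of n] by (simp add: good_def projection_def)
  have le: "R (n + k) * R n = R (n + k)" for n k
  proof (induction k)
    case (Suc k)
    have "g (R (n + k)) * R n = g (R (n + k))" by (metis Suc gR(3) mult.assoc)
    then show ?case by (simp add: RS left_diff_distrib Suc)
  qed (simp add: RR)
  have ortho: "g (R m) * g (R n) = 0" if "n < m" for m n
  proof -
    have "R (Suc n) * g (R n) = 0"
      using gR(2,4)[of n] by (simp add: RS left_diff_distrib projection_def)
    moreover have "g (R m) = g (R m) * R (Suc n)"
      using le[of "Suc n" "m - Suc n"] that gR(3)[of m] by (metis Suc_leI le_add_diff_inverse mult.assoc)
    ultimately show ?thesis by (metis mult.assoc mult_zero_right)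
  qed
  show thesis
  proof
    show "g (R k) \<in> D" "projection (g (R k))" "g (R k) \<noteq> 0" for k using gR by auto
    show "g (R j) * g (R k) = 0" if "j \<noteq> k" for j k
    proof (cases "k < j")
      case False
      then have "g (R k) * g (R j) = 0" using ortho that by simp
      moreover have "g (R j) * g (R k) = g (R k) * g (R j)"
        using D gR(1) by (auto simp: masa_def abelian_def)
      ultimately show ?thesis by simp
    qed (rule ortho)
  qed
qed

section \<open>Orthogonal expansions\<close>

text \<open>Zero vectors are admitted in the family because the orthogonalization of a dense sequence
  produces them.\<close>

lemma bessel_identity:
  fixes e :: "'i \<Rightarrow> 'h::complex_inner"
  assumes "finite A" and "\<And>i j. i \<in> A \<Longrightarrow> j \<in> A \<Longrightarrow> i \<noteq> j \<Longrightarrow> cinner (e i) (e j) = 0"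
    and "\<And>i. i \<in> A \<Longrightarrow> norm (e i) = 1 \<or> e i = 0"
  shows "(norm (y - (\<Sum>i\<in>A. cinner y (e i) *\<^sub>C e i)))\<^sup>2
    = (norm y)\<^sup>2 - (\<Sum>i\<in>A. (cmod (cinner y (e i)))\<^sup>2)"
  using assms
proof (induction A rule: finite_induct)
  case (insert k A)
  define v where "v = y - (\<Sum>i\<in>A. cinner y (e i) *\<^sub>C e i)"
  define c where "c = cinner y (e k)"
  have "cinner v (e k) = c - (\<Sum>i\<in>A. cinner y (e i) * cinner (e i) (e k))"
    by (simp add: v_def c_def cinner_diff_left cinner_sum_left cinner_scaleC_left)
  also have "(\<Sum>i\<in>A. cinner y (e i) * cinner (e i) (e k)) = 0"
    using insert.prems(1) insert.hyps by (intro sum.neutral) auto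
  finally have vk: "cinner v (e k) = c" by simp
  have "inner v (c *\<^sub>C e k) = Re (cnj c * c)"
    by (simp add: Re_cinner[symmetric] cinner_scaleC_right vk)
  then have cross: "inner v (c *\<^sub>C e k) = (cmod c)\<^sup>2"
    by (simp add: cmod_power2 flip: power2_eq_square)
  have own: "(norm (c *\<^sub>C e k))\<^sup>2 = (cmod c)\<^sup>2"
    using insert.prems(2)[of k] by (auto simp: norm_scaleC c_def cinner_zero_right)
  have "(norm (y - (\<Sum>i\<in>insert k A. cinner y (e i) *\<^sub>C e i)))\<^sup>2 = (norm (v - c *\<^sub>C e k))\<^sup>2"
    using insert.hyps by (simp add: v_def c_def algebra_simps)
  also have "\<dots> = (norm v)\<^sup>2 - 2 * inner v (c *\<^sub>C e k) + (norm (c *\<^sub>C e k))\<^sup>2"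
    by (simp add: power2_norm_eq_inner inner_diff_left inner_diff_right inner_commute)
  also have "(norm v)\<^sup>2 = (norm y)\<^sup>2 - (\<Sum>i\<in>A. (cmod (cinner y (e i)))\<^sup>2)"
    unfolding v_def by (rule insert.IH) (use insert.prems in auto)
  finally show ?case using insert.hyps cross own by (simp add: c_def)
qed simp

lemma norm_orthonormal_sum:
  fixes f :: "'i \<Rightarrow> 'h::complex_inner"
  assumes "finite A" and "\<And>i j. i \<noteq> j \<Longrightarrow> cinner (f i) (f j) = 0" and "\<And>i. norm (f i) = 1"
  shows "(norm (\<Sum>i\<in>A. c i *\<^sub>C f i))\<^sup>2 = (\<Sum>i\<in>A. (cmod (c i))\<^sup>2)"
proof -
  define y where "y = (\<Sum>i\<in>A. c i *\<^sub>C f i)"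
  have "cinner y (f k) = c k" if "k \<in> A" for k
  proof -
    have "cinner y (f k) = (\<Sum>i\<in>A. c i * cinner (f i) (f k))"
      by (simp add: y_def cinner_sum_left cinner_scaleC_left)
    also have "\<dots> = (\<Sum>i\<in>A. if i = k then c i else 0)"
      by (intro sum.cong) (auto simp: assms cinner_self)
    finally show ?thesis using that assms(1) by simp
  qed
  then show ?thesis
    using bessel_identity[OF assms(1), of f y] assms by (simp add: y_def)
qed

text \<open>Since \<open>sgn 0 = 0\<close>, a vector depending linearly on its predecessors yields the zero vector.\<close>

function gram_schmidt :: "(nat \<Rightarrow> 'h::complex_inner) \<Rightarrow> nat \<Rightarrow> 'h" where
  "gram_schmidt x n = sgn (x n - (\<Sum>i<n. cinner (x n) (gram_schmidt x i) *\<^sub>C gram_schmidt x i))"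
  by auto
termination by (relation "Wellfounded.measure snd") auto

declare gram_schmidt.simps [simp del]

lemma gram_schmidt_norm: "norm (gram_schmidt x n) = 1 \<or> gram_schmidt x n = 0"
  by (subst (1 2) gram_schmidt.simps) (simp add: norm_sgn sgn_zero_iff)

lemma gram_schmidt_orthogonal:
  assumes "i \<noteq> j"
  shows "cinner (gram_schmidt x i) (gram_schmidt x j) = 0"
proof -
  let ?e = "gram_schmidt x"
  have lt: "cinner (?e n) (?e k) = 0" if "k < n" for k n
    using that
  proof (induction n arbitrary: k rule: less_induct)
    case (less n)
    define v where "v = x n - (\<Sum>i<n. cinner (x n) (?e i) *\<^sub>C ?e i)"
    have others: "cinner (?e i) (?e k) = 0" if "i < n" "i \<noteq> k" for i
    proof (cases "k < i")
      case False
      then show ?thesis using less.IH[OF less.prems, of i] that cinner_commute[of "?e i"] by simp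
    qed (rule less.IH[OF that(1)])
    have "cinner v (?e k) = cinner (x n) (?e k) - (\<Sum>i<n. cinner (x n) (?e i) * cinner (?e i) (?e k))"
      by (simp add: v_def cinner_diff_left cinner_sum_left cinner_scaleC_left)
    also have "(\<Sum>i<n. cinner (x n) (?e i) * cinner (?e i) (?e k))
        = (\<Sum>i<n. if i = k then cinner (x n) (?e k) * cinner (?e k) (?e k) else 0)"
      by (intro sum.cong) (auto simp: others)
    also have "\<dots> = cinner (x n) (?e k) * cinner (?e k) (?e k)" using less.prems by simp
    also have "\<dots> = cinner (x n) (?e k)"
      using gram_schmidt_norm[of x k] by (auto simp: cinner_self cinner_zero_right)
    finally have "cinner v (?e k) = 0" by simp
    then show ?case
      by (subst gram_schmidt.simps) (simp add: v_def[symmetric] sgn_div_norm cinner_scaleR_left)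
  qed
  from assms consider "i < j" | "j < i" by linarith
  then show ?thesis using lt[of i j] lt[of j i] cinner_commute[of "?e i" "?e j"] by cases auto
qed

lemma gram_schmidt_reproduces:
  assumes "n < N"
  shows "(\<Sum>i<N. cinner (x n) (gram_schmidt x i) *\<^sub>C gram_schmidt x i) = x n"
proof -
  let ?e = "gram_schmidt x"
  define v where "v = x n - (\<Sum>i<n. cinner (x n) (?e i) *\<^sub>C ?e i)"
  have en: "?e n = sgn v" unfolding v_def by (rule gram_schmidt.simps)
  have "cinner v (?e n) = cinner (x n) (?e n)"
    by (simp add: v_def cinner_diff_left cinner_sum_left cinner_scaleC_left gram_schmidt_orthogonal)
  moreover have "cinner v (sgn v) = of_real (norm v)"
    by (cases "v = 0") (simp_all add: sgn_div_norm scaleR_scaleC cinner_scaleC_right cinner_self power2_eq_square)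
  ultimately have "cinner (x n) (?e n) *\<^sub>C ?e n = norm v *\<^sub>R sgn v"
    by (simp add: en scaleR_scaleC)
  also have "\<dots> = v" by (cases "v = 0") (simp_all add: sgn_div_norm)
  finally have Suc_n: "(\<Sum>i<Suc n. cinner (x n) (?e i) *\<^sub>C ?e i) = x n" by (simp add: v_def)
  have later: "cinner (x n) (?e i) = 0" if "n < i" for i
    by (subst Suc_n[symmetric])
      (use that in \<open>simp add: cinner_add_left cinner_sum_left cinner_scaleC_left gram_schmidt_orthogonal\<close>)
  have "(\<Sum>i<N. cinner (x n) (?e i) *\<^sub>C ?e i) = (\<Sum>i<Suc n. cinner (x n) (?e i) *\<^sub>C ?e i)"
    by (rule sum.mono_neutral_right) (use assms later in auto)
  with Suc_n show ?thesis by simp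
qed

text \<open>Orthogonalize a dense sequence \<open>x\<close>. The remainder of the expansion of \<open>y\<close> vanishes for
  \<open>y = x n\<close> once the first \<open>n + 1\<close> terms are used, and it depends contractively on \<open>y\<close>.\<close>

lemma ex_parseval_sequence:
  assumes "separable_space (euclidean :: 'h::complex_inner topology)"
  obtains e :: "nat \<Rightarrow> 'h::complex_inner" where "\<And>y. (\<lambda>i. (cmod (cinner y (e i)))\<^sup>2) sums (norm y)\<^sup>2"
proof -
  obtain C :: "'h set" where C: "countable C" "closure C = UNIV"
    using assms by (auto simp: separable_space_def)
  then have "C \<noteq> {}" by auto
  define x where "x = from_nat_into C"
  have x: "range x = C" using C \<open>C \<noteq> {}\<close> by (simp add: x_def range_from_nat_into)
  define e where "e = gram_schmidt x"
  define res where "res N y = y - (\<Sum>i<N. cinner y (e i) *\<^sub>C e i)" for N y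
  have res_norm: "(norm (res N y))\<^sup>2 = (norm y)\<^sup>2 - (\<Sum>i<N. (cmod (cinner y (e i)))\<^sup>2)" for N y
    unfolding res_def e_def
    by (rule bessel_identity) (auto simp: gram_schmidt_orthogonal gram_schmidt_norm)
  have res_le: "norm (res N y) \<le> norm y" for N y
    by (rule power2_le_imp_le) (auto simp: res_norm sum_nonneg)
  have res_x: "res N (x n) = 0" if "n < N" for n N
    using gram_schmidt_reproduces[OF that, of x] by (simp add: res_def e_def)
  have res_diff: "res N (y - z) = res N y - res N z" for N y z
    by (simp add: res_def cinner_diff_left complex_vector.scale_left_diff_distrib sum_subtractf)
  have "(\<lambda>i. (cmod (cinner y (e i)))\<^sup>2) sums (norm y)\<^sup>2" for y
  proof -
    have "(\<lambda>N. res N y) \<longlonglongrightarrow> 0"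
    proof (rule LIMSEQ_I)
      fix r :: real assume "r > 0"
      then obtain z where "z \<in> C" "dist z y < r"
        using C(2) by (metis UNIV_I closure_approachable)
      then obtain n where n: "norm (y - x n) < r" using x by (auto simp: dist_norm norm_minus_commute)
      have "norm (res N y - 0) < r" if "Suc n \<le> N" for N
        using res_le[of N "y - x n"] res_x[of n N] n that by (simp add: res_diff)
      then show "\<exists>no. \<forall>N\<ge>no. norm (res N y - 0) < r" by blast
    qed
    then have "(\<lambda>N. (norm y)\<^sup>2 - (norm (res N y))\<^sup>2) \<longlonglongrightarrow> (norm y)\<^sup>2 - (norm (0::'h))\<^sup>2"
      by (intro tendsto_intros)
    then show ?thesis by (simp add: sums_def res_norm)
  qed
  then show thesis by (rule that)
qed

lemma ex_operator_with_coefficients: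
  fixes a f :: "nat \<Rightarrow> 'h::chilbert_space"
  assumes bessel: "\<And>x N. (\<Sum>k<N. (cmod (cinner x (a k)))\<^sup>2) \<le> (norm x)\<^sup>2"
    and orth: "\<And>j k. j \<noteq> k \<Longrightarrow> cinner (f j) (f k) = 0" and unit: "\<And>k. norm (f k) = 1"
  obtains b where "\<And>x k. cinner (bop_apply b x) (f k) = cinner x (a k)"
proof -
  let ?g = "\<lambda>x k. cinner x (a k) *\<^sub>C f k"
  have sm: "summable (?g x)" for x
  proof -
    have "summable (\<lambda>k. (cmod (cinner x (a k)))\<^sup>2)"
      by (rule bounded_imp_summable[where B = "(norm x)\<^sup>2"])
        (use bessel[of x "Suc _"] in \<open>auto simp: lessThan_Suc_atMost\<close>)
    note sC = this[unfolded summable_Cauchy]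
    show ?thesis unfolding summable_Cauchy
    proof (intro allI impI)
      fix r :: real assume r: "r > 0"
      then obtain M where M: "\<And>m n. m \<ge> M \<Longrightarrow> norm (\<Sum>k=m..<n. (cmod (cinner x (a k)))\<^sup>2) < r\<^sup>2"
        using sC[rule_format, of "r\<^sup>2"] by auto
      have "norm (sum (?g x) {m..<n}) < r" if "m \<ge> M" for m n
      proof -
        have "(norm (sum (?g x) {m..<n}))\<^sup>2 < r\<^sup>2"
          using M[OF that, of n] by (subst norm_orthonormal_sum) (auto simp: orth unit)
        then show ?thesis using r by (simp add: power_less_imp_less_base)
      qed
      then show "\<exists>N. \<forall>m\<ge>N. \<forall>n. norm (sum (?g x) {m..<n}) < r" by blast
    qed
  qed
  obtain b where b: "bop_apply b = (\<lambda>x. suminf (?g x))"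
  proof (rule ex_bop)
    show "suminf (?g (x + y)) = suminf (?g x) + suminf (?g y)" for x y
      by (simp add: suminf_add[OF sm sm] cinner_add_left scaleC_add_left)
    show "suminf (?g (c *\<^sub>C x)) = c *\<^sub>C suminf (?g x)" for c x
      using bounded_linear.suminf[OF bounded_linear_scaleC_right sm, of c x]
      by (simp add: cinner_scaleC_left scaleC_scaleC)
    show "norm (suminf (?g x)) \<le> norm x * 1" for x
    proof (rule LIMSEQ_le_const2[OF tendsto_norm[OF summable_LIMSEQ[OF sm]]], intro exI allI impI)
      fix N :: nat
      show "norm (sum (?g x) {..<N}) \<le> norm x * 1"
      proof (rule power2_le_imp_le)
        have "(norm (sum (?g x) {..<N}))\<^sup>2 = (\<Sum>k<N. (cmod (cinner x (a k)))\<^sup>2)"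
          by (rule norm_orthonormal_sum) (auto simp: orth unit)
        with bessel[of x N] show "(norm (sum (?g x) {..<N}))\<^sup>2 \<le> (norm x * 1)\<^sup>2" by simp
      qed simp
    qed
  qed
  have "cinner (bop_apply b x) (f k) = cinner x (a k)" for x k
  proof -
    have "cinner (bop_apply b x) (f k) = (\<Sum>j. cinner x (a j) * cinner (f j) (f k))"
      using bounded_linear.suminf[OF bounded_linear_cinner_left sm, of x "f k"]
      by (simp add: b cinner_scaleC_left)
    also have "\<dots> = (\<Sum>j\<in>{k}. cinner x (a j) * cinner (f j) (f k))"
      by (rule suminf_finite) (auto simp: orth)
    finally show ?thesis by (simp add: cinner_self unit)
  qed
  then show thesis by (rule that)
qed

section \<open>An operator that spreads out every subprojection\<close>

lemma projection_sum:
  fixes r :: "'i \<Rightarrow> 'a::cstar_algebra"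
  assumes "\<And>k. projection (r k)" and "\<And>j k. j \<noteq> k \<Longrightarrow> r j * r k = 0" and "finite L"
  shows "projection (\<Sum>k\<in>L. r k)"
proof -
  have "(\<Sum>j\<in>L. r j * r k) = r k" if "k \<in> L" for k
  proof -
    have "(\<Sum>j\<in>L. r j * r k) = (\<Sum>j\<in>L. if j = k then r k else 0)"
      by (intro sum.cong) (use assms in \<open>auto simp: projection_def\<close>)
    then show ?thesis using that \<open>finite L\<close> by simp
  qed
  then show ?thesis using assms(1)
    by (simp add: projection_def star_sum sum_product sum.swap[of _ L L])
qed

lemma bop_apply_sum: "bop_apply (\<Sum>k\<in>L. T k) x = (\<Sum>k\<in>L. bop_apply (T k) x)"
  by (induction L rule: infinite_finite_induct) (simp_all add: bop_apply_add_left)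

text \<open>The sum of the \<open>r k\<close> is again a projection, and for a projection the quadratic form is the
  squared norm of the image.\<close>

lemma projection_bessel:
  fixes r :: "'i \<Rightarrow> 'h::chilbert_space bop"
  assumes r: "\<And>k. projection (r k)" "\<And>j k. j \<noteq> k \<Longrightarrow> r j * r k = 0" and L: "finite L"
  shows "(\<Sum>k\<in>L. (norm (bop_apply (r k) x))\<^sup>2) \<le> (norm x)\<^sup>2"
proof -
  have form: "(norm (bop_apply p x))\<^sup>2 = inner (bop_apply p x) x" if "projection p" for p
    using that unfolding projection_def selfadjoint_iff power2_norm_eq_inner
    by (metis bop_apply_mult inner_commute)
  define R where "R = (\<Sum>k\<in>L. r k)"
  have R: "projection R" unfolding R_def using r L by (rule projection_sum)
  have "(\<Sum>k\<in>L. (norm (bop_apply (r k) x))\<^sup>2) = inner (bop_apply R x) x"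
    by (simp add: form[OF r(1)] R_def bop_apply_sum inner_sum_left)
  also have "\<dots> = (norm (bop_apply R x))\<^sup>2" by (simp add: form[OF R])
  also have "\<dots> \<le> (norm x)\<^sup>2"
    using norm_bop_apply[of R x] mult_right_mono[OF norm_projection_le_1[OF R], of "norm x"]
    by (intro power_mono) auto
  finally show ?thesis .
qed

text \<open>The index \<open>k\<close> encodes a triple \<open>(m, j, i)\<close>. For \<open>j \<le> m\<close> it belongs to the frame vector
  \<open>r m (e i) / sqrt (m + 1)\<close>: every vector \<open>r m (e i)\<close> is replaced by \<open>m + 1\<close> equal copies of total
  mass one. The triples with \<open>j > m\<close> get the zero vector.

  A finite set \<open>F\<close> with \<open>2 * card F \<le> m + 1\<close> thus carries at most half the mass of a vector in the
  range of \<open>r m\<close>, and up to \<open>\<delta>\<close> the rest is seen on a finite set \<open>L\<close>.\<close>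

lemma ex_spreading_operator:
  fixes r :: "nat \<Rightarrow> 'h::chilbert_space bop"
  assumes sep: "separable_space (euclidean :: 'h topology)"
    and r: "\<And>k. projection (r k)" "\<And>k. r k \<noteq> 0" "\<And>j k. j \<noteq> k \<Longrightarrow> r j * r k = 0"
  obtains b where "\<And>m \<xi> F \<delta>. bop_apply (r m) \<xi> = \<xi> \<Longrightarrow> finite F \<Longrightarrow> 2 * card F \<le> Suc m \<Longrightarrow> \<delta> > 0
    \<Longrightarrow> \<exists>L. finite L \<and> L \<inter> F = {} \<and>
          (norm \<xi>)\<^sup>2 / 2 - \<delta> \<le> (norm (bop_apply (\<Sum>l\<in>L. r l) (bop_apply b \<xi>)))\<^sup>2"
proof -
  obtain e :: "nat \<Rightarrow> 'h" where e: "\<And>y. (\<lambda>i. (cmod (cinner y (e i)))\<^sup>2) sums (norm y)\<^sup>2"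
    using ex_parseval_sequence[OF sep] by metis
  have e_part: "(\<Sum>i\<in>I. (cmod (cinner y (e i)))\<^sup>2) \<le> (norm y)\<^sup>2" if "finite I" for y I
    using sum_le_suminf[OF sums_summable[OF e[of y]] that] sums_unique[OF e[of y]] by simp
  have r_sa: "star (r k) = r k" for k using r(1) by (simp add: projection_def)
  have r_shift: "cinner (bop_apply (r k) x) y = cinner x (bop_apply (r k) y)" for k x y
    using cinner_star_right[of x "r k" y] by (simp add: r_sa)
  have rr: "bop_apply (r k) (bop_apply (r k) x) = bop_apply (r k) x" for k x
    using r(1)[of k] by (metis projection_def bop_apply_mult)
  have "\<exists>y. norm y = 1 \<and> bop_apply (r k) y = y" for k
  proof -
    obtain x where x: "bop_apply (r k) x \<noteq> 0" using r(2)[of k] bop_eqI[of "r k" 0] by auto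
    show ?thesis
      by (rule exI[of _ "sgn (bop_apply (r k) x)"])
        (simp add: norm_sgn x sgn_div_norm bop_apply_scaleR rr)
  qed
  then obtain f where f: "\<And>k. norm (f k) = 1" "\<And>k. bop_apply (r k) (f k) = f k" by metis
  have rf: "bop_apply (r j) (f k) = 0" if "j \<noteq> k" for j k
    using r(3)[OF that] f(2)[of k] by (metis bop_apply_mult bop_apply_zero(1))
  have f_orth: "cinner (f j) (f k) = 0" if "j \<noteq> k" for j k
    using r_shift[of j "f j" "f k"] rf[OF that] f(2) by (simp add: cinner_zero_right)
  define idx where "idx m = (\<lambda>(j, i). prod_encode (m, prod_encode (j, i)))" for m
  define a where "a k = (case prod_decode k of (m, l) \<Rightarrow> case prod_decode l of (j, i) \<Rightarrow>
      if j \<le> m then (1 / sqrt (Suc m)) *\<^sub>R bop_apply (r m) (e i) else 0)" for k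
  define w where "w x k = (cmod (cinner x (a k)))\<^sup>2" for x k
  have w_idx: "w x (idx m (j, i)) = (if j \<le> m then (cmod (cinner (bop_apply (r m) x) (e i)))\<^sup>2 / Suc m else 0)"
    for x m j i
    by (simp add: w_def a_def idx_def r_shift scaleR_scaleC cinner_scaleC_right cinner_zero_right
        norm_mult norm_divide power_mult_distrib power_divide)
  have inj_idx: "inj_on (idx m) A" for m A
    by (auto simp: inj_on_def idx_def)
  have a_bessel: "(\<Sum>k<N. (cmod (cinner x (a k)))\<^sup>2) \<le> (norm x)\<^sup>2" for x N
  proof -
    let ?I = "(\<lambda>(m, q). idx m q) :: nat \<times> nat \<times> nat \<Rightarrow> nat"
    let ?B = "{..<N} \<times> {..<N} \<times> {..<N}"
    have "{..<N} \<subseteq> ?I ` ?B"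
    proof
      fix k assume k: "k \<in> {..<N}"
      obtain m l where ml: "prod_decode k = (m, l)" by (cases "prod_decode k")
      obtain j i where ji: "prod_decode l = (j, i)" by (cases "prod_decode l")
      have l_eq: "prod_encode (j, i) = l" by (metis ji prod_decode_inverse)
      have k_eq: "prod_encode (m, l) = k" by (metis ml prod_decode_inverse)
      have "m \<le> k" "l \<le> k" "j \<le> l" "i \<le> l"
        using le_prod_encode_1[of m l] le_prod_encode_2[of l m] le_prod_encode_1[of j i]
          le_prod_encode_2[of i j] by (simp_all add: l_eq k_eq)
      then have "(m, j, i) \<in> ?B" using k by auto
      moreover have "k = ?I (m, j, i)" by (simp add: idx_def l_eq k_eq)
      ultimately show "k \<in> ?I ` ?B" by (rule rev_image_eqI)
    qed
    then have "(\<Sum>k<N. w x k) \<le> (\<Sum>k\<in>?I ` ?B. w x k)"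
      by (intro sum_mono2) (auto simp: w_def)
    also have "\<dots> = (\<Sum>q\<in>?B. w x (?I q))"
      by (subst sum.reindex) (auto simp: inj_on_def idx_def)
    also have "\<dots> = (\<Sum>m<N. \<Sum>j<N. \<Sum>i<N. w x (idx m (j, i)))"
      by (auto simp: sum.cartesian_product intro!: sum.cong)
    also have "\<dots> \<le> (\<Sum>m<N. (norm (bop_apply (r m) x))\<^sup>2)"
    proof (rule sum_mono)
      fix m
      let ?y = "bop_apply (r m) x"
      have "(\<Sum>j<N. \<Sum>i<N. w x (idx m (j, i))) \<le> (\<Sum>j<N. if j \<le> m then (norm ?y)\<^sup>2 / Suc m else 0)"
        using e_part[of "{..<N}" ?y]
        by (intro sum_mono) (auto simp: w_idx divide_right_mono simp flip: sum_divide_distrib)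
      also have "\<dots> = (\<Sum>j\<in>{j\<in>{..<N}. j \<le> m}. (norm ?y)\<^sup>2 / Suc m)"
        by (rule sum.inter_filter[symmetric]) simp
      also have "\<dots> \<le> (\<Sum>j\<le>m. (norm ?y)\<^sup>2 / Suc m)"
        by (rule sum_mono2) auto
      finally show "(\<Sum>j<N. \<Sum>i<N. w x (idx m (j, i))) \<le> (norm ?y)\<^sup>2" by simp
    qed
    also have "\<dots> \<le> (norm x)\<^sup>2" by (rule projection_bessel) (auto intro: r)
    finally show ?thesis by (simp add: w_def)
  qed
  obtain b where b: "\<And>x k. cinner (bop_apply b x) (f k) = cinner x (a k)"
    using ex_operator_with_coefficients[where f = f, OF a_bessel f_orth f(1)] by blast
  \<comment> \<open>Only the coefficients along the vectors \<open>f l\<close> are compared, so Bessel's inequality suffices.\<close>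
  have lower: "(\<Sum>l\<in>L. w \<xi> l) \<le> (norm (bop_apply (\<Sum>l\<in>L. r l) (bop_apply b \<xi>)))\<^sup>2" if L: "finite L" for L \<xi>
  proof -
    define y where "y = bop_apply (\<Sum>l\<in>L. r l) (bop_apply b \<xi>)"
    have "cinner y (f k) = cinner \<xi> (a k)" if "k \<in> L" for k
    proof -
      have "cinner y (f k) = (\<Sum>l\<in>L. cinner (bop_apply b \<xi>) (bop_apply (r l) (f k)))"
        by (simp add: y_def bop_apply_sum cinner_sum_left r_shift)
      also have "\<dots> = (\<Sum>l\<in>L. if l = k then cinner (bop_apply b \<xi>) (f k) else 0)"
        by (intro sum.cong) (auto simp: f(2) rf cinner_zero_right)
      finally show ?thesis using that L by (simp add: b)
    qed
    moreover have "0 \<le> (norm y)\<^sup>2 - (\<Sum>k\<in>L. (cmod (cinner y (f k)))\<^sup>2)"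
      by (subst bessel_identity[symmetric]) (auto simp: L f_orth f(1))
    ultimately show ?thesis by (simp add: w_def y_def)
  qed
  show thesis
  proof (rule that[of b])
    fix m \<xi> and F :: "nat set" and \<delta> :: real
    assume \<xi>: "bop_apply (r m) \<xi> = \<xi>" and F: "finite F" "2 * card F \<le> Suc m" and \<delta>: "\<delta> > 0"
    have "(\<lambda>I. \<Sum>i<I. (cmod (cinner \<xi> (e i)))\<^sup>2) \<longlonglongrightarrow> (norm \<xi>)\<^sup>2"
      using e[of \<xi>] by (simp add: sums_def)
    then have "\<forall>\<^sub>F I in sequentially. (norm \<xi>)\<^sup>2 - \<delta> < (\<Sum>i<I. (cmod (cinner \<xi> (e i)))\<^sup>2)"
      by (rule order_tendstoD(1)) (use \<delta> in simp)
    then obtain I where I: "(norm \<xi>)\<^sup>2 - \<delta> < (\<Sum>i<I. (cmod (cinner \<xi> (e i)))\<^sup>2)"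
      by (auto simp: eventually_sequentially)
    define L where "L = idx m ` ({..m} \<times> {..<I})"
    have fin: "finite L" by (simp add: L_def)
    have "(\<Sum>l\<in>L. w \<xi> l) = (\<Sum>j\<le>m. \<Sum>i<I. w \<xi> (idx m (j, i)))"
      unfolding L_def by (subst sum.reindex[OF inj_idx]) (simp add: sum.cartesian_product)
    also have "\<dots> = (\<Sum>i<I. (cmod (cinner \<xi> (e i)))\<^sup>2)"
      by (simp add: w_idx \<xi> flip: sum_divide_distrib)
    finally have total: "(norm \<xi>)\<^sup>2 - \<delta> < (\<Sum>l\<in>L. w \<xi> l)" using I by simp
    have each: "w \<xi> l \<le> (norm \<xi>)\<^sup>2 / Suc m" if "l \<in> L" for l
      using that e_part[of "{_}" \<xi>] by (auto simp: L_def w_idx \<xi> intro!: divide_right_mono)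
    have "(\<Sum>l\<in>L \<inter> F. w \<xi> l) \<le> card (L \<inter> F) * ((norm \<xi>)\<^sup>2 / Suc m)"
      using each by (intro sum_bounded_above) auto
    also have "\<dots> \<le> (Suc m / 2) * ((norm \<xi>)\<^sup>2 / Suc m)"
    proof (rule mult_right_mono)
      have "card (L \<inter> F) \<le> card F" by (rule card_mono) (use F in auto)
      with F(2) have "real (2 * card (L \<inter> F)) \<le> real (Suc m)" by (simp only: of_nat_le_iff)
      then show "real (card (L \<inter> F)) \<le> real (Suc m) / 2" by simp
    qed simp
    also have "\<dots> = (norm \<xi>)\<^sup>2 / 2" by (simp add: field_simps del: of_nat_Suc)
    finally have lost: "(\<Sum>l\<in>L \<inter> F. w \<xi> l) \<le> (norm \<xi>)\<^sup>2 / 2" .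
    have "(\<Sum>l\<in>L. w \<xi> l) = (\<Sum>l\<in>L \<inter> F. w \<xi> l) + (\<Sum>l\<in>L - F. w \<xi> l)"
      by (rule sum.Int_Diff[OF fin])
    with total lost have "(norm \<xi>)\<^sup>2 / 2 - \<delta> \<le> (\<Sum>l\<in>L - F. w \<xi> l)" by linarith
    also have "\<dots> \<le> (norm (bop_apply (\<Sum>l\<in>L - F. r l) (bop_apply b \<xi>)))\<^sup>2"
      using fin by (intro lower) simp
    finally show "\<exists>L. finite L \<and> L \<inter> F = {} \<and>
        (norm \<xi>)\<^sup>2 / 2 - \<delta> \<le> (norm (bop_apply (\<Sum>l\<in>L. r l) (bop_apply b \<xi>)))\<^sup>2"
      using fin by (intro exI[of _ "L - F"]) auto
  qed
qed

section \<open>Normalizers\<close>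

text \<open>If \<open>r k * n * p \<noteq> 0\<close>, then \<open>d = n\<^sup>* r\<^sub>k n\<close> lies in \<open>D\<close> and cuts \<open>p\<close> down to the part that \<open>n\<close> carries
  into \<open>r k\<close>: for \<open>l \<noteq> k\<close> the product \<open>r l * n * d\<close> contains \<open>r l * (n n\<^sup>*) * r k\<close>. The unit \<open>u\<close> of \<open>D\<close>
  is inserted between \<open>n\<close> and \<open>n\<^sup>*\<close> so that the middle factor lies in \<open>D\<close> and commutes with \<open>r k\<close>,
  even if \<open>u\<close> is not a unit for the whole algebra.\<close>

lemma normalizer_localizes:
  fixes D :: "'b::cstar_algebra set" and r :: "'i \<Rightarrow> 'b"
  assumes ab: "abelian D" and u: "u \<in> D" "\<And>d. d \<in> D \<Longrightarrow> u * d = d"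
    and mult: "\<And>x y. x \<in> D \<Longrightarrow> y \<in> D \<Longrightarrow> x * y \<in> D"
    and r: "\<And>k. r k \<in> D" "\<And>k. projection (r k)" "\<And>j k. j \<noteq> k \<Longrightarrow> r j * r k = 0"
    and n: "n \<in> normalizers D" and p: "p \<in> D" "p \<noteq> 0"
  shows "\<exists>d\<in>D. p * d \<noteq> 0 \<and> (\<exists>k. \<forall>l. l \<noteq> k \<longrightarrow> r l * n * (p * d) = 0)"
proof (cases "\<forall>l. r l * n * p = 0")
  case True
  have "p * u = p" using ab u p by (metis abelian_def)
  then show ?thesis using True u(1) p(2) by (intro bexI[of _ u]) auto
next
  case False
  then obtain k where k: "r k * n * p \<noteq> 0" by blast
  have comm: "x * y = y * x" if "x \<in> D" "y \<in> D" for x y using ab that by (simp add: abelian_def)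
  define d where "d = star n * r k * n"
  have dD: "d \<in> D" and nn: "n * u * star n \<in> D"
    using n r(1)[of k] u(1) by (auto simp: normalizers_def d_def)
  have rk: "star (r k) = r k" "r k * r k = r k" using r(2)[of k] by (simp_all add: projection_def)
  have pd: "p * d = d * p" using comm p(1) dD by blast
  have "star (r k * n * p) * (r k * n * p) = star p * (star n * (r k * r k) * n * p)"
    by (simp add: star_mult rk(1) mult.assoc)
  also have "\<dots> = star p * (d * p)" unfolding rk(2) d_def by (simp only: mult.assoc)
  finally have "p * d \<noteq> 0" using k pd by (metis mult_zero_right star_mult_self_eq_0_iff)
  moreover have "r l * n * (p * d) = 0" if "l \<noteq> k" for l
  proof -
    have "r l * n * (p * d) = r l * n * (u * d * p)" using pd u(2)[OF dD] by simp
    also have "\<dots> = r l * ((n * u * star n) * r k) * n * p" by (simp add: d_def mult.assoc)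
    also have "\<dots> = (r l * r k) * (n * u * star n) * n * p"
      using comm[OF nn r(1)[of k]] by (simp add: mult.assoc)
    finally show ?thesis using r(3)[OF that] by simp
  qed
  ultimately show ?thesis using dD by blast
qed

text \<open>The bound \<open>N\<close> is the number of normalizers in a representation of \<open>x\<close>, and it is uniform in \<open>p\<close>.
  Adding one normalizer shrinks \<open>p * d\<close> once more, which preserves all the equations already
  obtained.\<close>

lemma span_normalizers_localizes:
  fixes D :: "'b::cstar_algebra set" and r :: "'i \<Rightarrow> 'b"
  assumes ab: "abelian D" and u: "u \<in> D" "\<And>d. d \<in> D \<Longrightarrow> u * d = d"
    and mult: "\<And>x y. x \<in> D \<Longrightarrow> y \<in> D \<Longrightarrow> x * y \<in> D"
    and r: "\<And>k. r k \<in> D" "\<And>k. projection (r k)" "\<And>j k. j \<noteq> k \<Longrightarrow> r j * r k = 0"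
    and x: "x \<in> cspan (normalizers D)"
  shows "\<exists>N. \<forall>p\<in>D. p \<noteq> 0 \<longrightarrow> (\<exists>d\<in>D. p * d \<noteq> 0 \<and>
           (\<exists>F. finite F \<and> card F \<le> N \<and> (\<forall>l. l \<notin> F \<longrightarrow> r l * x * (p * d) = 0)))"
  using x
proof (induction rule: complex_vector.span_induct_alt)
  case base
  have "p * u = p" if "p \<in> D" for p using ab u that by (metis abelian_def)
  then show ?case using u(1) by (intro exI[of _ 0]) (auto intro!: bexI[of _ u] exI[of _ "{}"])
next
  case (step c n x)
  then obtain N where N: "\<And>p. p \<in> D \<Longrightarrow> p \<noteq> 0 \<Longrightarrow> \<exists>d\<in>D. p * d \<noteq> 0 \<and>
      (\<exists>F. finite F \<and> card F \<le> N \<and> (\<forall>l. l \<notin> F \<longrightarrow> r l * x * (p * d) = 0))" by blast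
  show ?case
  proof (intro exI[of _ "Suc N"] ballI impI)
    fix p assume p: "p \<in> D" "p \<noteq> 0"
    obtain d F where d: "d \<in> D" "p * d \<noteq> 0" and F: "finite F" "card F \<le> N"
      "\<And>l. l \<notin> F \<Longrightarrow> r l * x * (p * d) = 0" using N[OF p] by blast
    obtain d' k where d': "d' \<in> D" "p * d * d' \<noteq> 0" and k: "\<And>l. l \<noteq> k \<Longrightarrow> r l * n * (p * d * d') = 0"
      using normalizer_localizes[where r = r, OF ab u mult r step(1) mult[OF p(1) d(1)] d(2)] by blast
    have "r l * (c *\<^sub>C n + x) * (p * (d * d')) = 0" if "l \<notin> insert k F" for l
    proof -
      have "r l * x * (p * d * d') = r l * x * (p * d) * d'" by (simp add: mult.assoc)
      then have "r l * x * (p * d * d') = 0" using F(3)[of l] that by simp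
      with k[of l] that show ?thesis
        by (simp add: distrib_left distrib_right mult_scaleC_left mult_scaleC_right mult.assoc)
    qed
    moreover have "card (insert k F) \<le> Suc N" using F by (simp add: card_insert_if)
    ultimately show "\<exists>d\<in>D. p * d \<noteq> 0 \<and>
        (\<exists>F. finite F \<and> card F \<le> Suc N \<and> (\<forall>l. l \<notin> F \<longrightarrow> r l * (c *\<^sub>C n + x) * (p * d) = 0))"
      using F(1) d' mult[OF d(1) d'(1)]
      by (intro bexI[of _ "d * d'"] conjI exI[of _ "insert k F"]) (auto simp: mult.assoc)
  qed
qed

section \<open>Inclusions containing all bounded operators are not regular\<close>

theorem theorem3p7:
  fixes D :: "'h::chilbert_space bop set"
  assumes separable: "separable_space (euclidean :: 'h topology)"
    and infinite_dimensional: "\<not> (\<exists>S :: 'h set. finite S \<and> cspan S = UNIV)"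
    and masa: "masa D"
  shows "\<not> (\<exists>\<iota> :: 'h bop \<Rightarrow> 'b::cstar_algebra.
            cstar_embedding \<iota> \<and> regular_masa_inclusion (\<iota> ` D))"
proof
  assume "\<exists>\<iota> :: 'h bop \<Rightarrow> 'b. cstar_embedding \<iota> \<and> regular_masa_inclusion (\<iota> ` D)"
  then obtain \<iota> :: "'h bop \<Rightarrow> 'b" where emb: "cstar_embedding \<iota>"
    and reg: "regular_masa_inclusion (\<iota> ` D)" by blast
  have \<iota>_add: "\<iota> (x + y) = \<iota> x + \<iota> y" and \<iota>_mult: "\<iota> (x * y) = \<iota> x * \<iota> y"
    and \<iota>_star: "\<iota> (star x) = star (\<iota> x)" and \<iota>_norm: "norm (\<iota> x) = norm x" for x y
    using emb by (simp_all add: cstar_embedding_def)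
  have \<iota>_0: "\<iota> 0 = 0" using \<iota>_norm[of 0] by simp
  have \<iota>_0_iff: "\<iota> x = 0 \<longleftrightarrow> x = 0" for x using \<iota>_norm[of x] by (metis norm_eq_zero)
  have \<iota>_sum: "\<iota> (\<Sum>k\<in>L. T k) = (\<Sum>k\<in>L. \<iota> (T k))" for T :: "nat \<Rightarrow> 'h bop" and L
    by (induction L rule: infinite_finite_induct) (simp_all add: \<iota>_0 \<iota>_add)
  have ab: "abelian (\<iota> ` D)" and dense: "closure (cspan (normalizers (\<iota> ` D))) = UNIV"
    and mult: "\<And>x y. x \<in> \<iota> ` D \<Longrightarrow> y \<in> \<iota> ` D \<Longrightarrow> x * y \<in> \<iota> ` D"
    using reg by (auto simp: regular_masa_inclusion_def regular_inclusion_def cstar_subalgebra_def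
        star_subalgebra_def)
  have "infinite_rank (id_bop :: 'h bop)"
    using infinite_dimensional unfolding infinite_rank_def by (auto simp: top.extremum_unique)
  then obtain r :: "nat \<Rightarrow> 'h bop" where r: "\<And>k. r k \<in> D" "\<And>k. projection (r k)" "\<And>k. r k \<noteq> 0"
    "\<And>j k. j \<noteq> k \<Longrightarrow> r j * r k = 0"
    using masa_infinite_orthogonal_projections[OF masa] by metis
  obtain b where b: "\<And>m \<xi> F \<delta>. bop_apply (r m) \<xi> = \<xi> \<Longrightarrow> finite F \<Longrightarrow> 2 * card F \<le> Suc m \<Longrightarrow> \<delta> > 0
    \<Longrightarrow> \<exists>L. finite L \<and> L \<inter> F = {} \<and>
          (norm \<xi>)\<^sup>2 / 2 - \<delta> \<le> (norm (bop_apply (\<Sum>l\<in>L. r l) (bop_apply b \<xi>)))\<^sup>2"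
    using ex_spreading_operator[where r = r, OF separable r(2,3,4)] by blast
  obtain x where x: "x \<in> cspan (normalizers (\<iota> ` D))" "norm (x - \<iota> b) < 1/2"
  proof -
    have "\<iota> b \<in> closure (cspan (normalizers (\<iota> ` D)))" using dense by simp
    then have "\<exists>x\<in>cspan (normalizers (\<iota> ` D)). dist x (\<iota> b) < 1/2"
      unfolding closure_approachable by (rule spec[of _ "1/2", THEN mp]) simp
    then show thesis using that by (auto simp: dist_norm)
  qed
  have \<iota>r: "\<iota> (r k) \<in> \<iota> ` D" "projection (\<iota> (r k))" for k
    using r(1,2)[of k] by (auto simp: projection_def simp flip: \<iota>_star \<iota>_mult)
  have \<iota>r_orth: "\<iota> (r j) * \<iota> (r k) = 0" if "j \<noteq> k" for j k
    using r(4)[OF that] by (simp add: \<iota>_0 flip: \<iota>_mult)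
  have unit: "\<iota> id_bop \<in> \<iota> ` D" "\<And>d. d \<in> \<iota> ` D \<Longrightarrow> \<iota> id_bop * d = d"
    using id_bop_in_masa[OF masa] by (auto simp flip: \<iota>_mult)
  obtain N where N: "\<And>p. p \<in> \<iota> ` D \<Longrightarrow> p \<noteq> 0 \<Longrightarrow> \<exists>d\<in>\<iota> ` D. p * d \<noteq> 0 \<and>
      (\<exists>F. finite F \<and> card F \<le> N \<and> (\<forall>l. l \<notin> F \<longrightarrow> \<iota> (r l) * x * (p * d) = 0))"
    using span_normalizers_localizes[where r = "\<lambda>k. \<iota> (r k)", OF ab unit mult \<iota>r \<iota>r_orth x(1)] by blast
  \<comment> \<open>Large enough for \<open>N\<close> of the \<open>r k\<close> to carry at most half the mass of a vector in the range of
    \<open>r m\<close>.\<close>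
  define m where "m = 2 * N"
  obtain d F where d: "d \<in> D" "\<iota> (r m) * \<iota> d \<noteq> 0" and F: "finite F" "card F \<le> N"
    "\<And>l. l \<notin> F \<Longrightarrow> \<iota> (r l) * x * (\<iota> (r m) * \<iota> d) = 0"
    using N[OF \<iota>r(1)[of m]] r(3)[of m] by (auto simp: \<iota>_0_iff)
  define c where "c = r m * d"
  have \<iota>c: "\<iota> c = \<iota> (r m) * \<iota> d" by (simp add: c_def \<iota>_mult)
  have c: "c \<noteq> 0" using d(2) \<iota>_0 by (auto simp flip: \<iota>c)
  have rc: "r m * c = c" using r(2)[of m] by (simp add: c_def projection_def flip: mult.assoc)
  have Fc: "\<iota> (r l) * x * \<iota> c = 0" if "l \<notin> F" for l using F(3)[OF that] by (simp add: \<iota>c)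
  \<comment> \<open>Away from \<open>F\<close> the approximant \<open>x\<close> vanishes on \<open>c\<close>, so \<open>b\<close> is small there.\<close>
  have small: "norm ((\<Sum>l\<in>L. r l) * b * c) \<le> 1/2 * norm c" if L: "finite L" "L \<inter> F = {}" for L
  proof -
    define R where "R = (\<Sum>l\<in>L. r l)"
    have "\<iota> R * x * \<iota> c = (\<Sum>l\<in>L. \<iota> (r l) * x * \<iota> c)" by (simp add: R_def \<iota>_sum sum_distrib_right)
    also have "\<dots> = 0" using L(2) by (intro sum.neutral ballI Fc) auto
    finally have "\<iota> (R * b * c) = \<iota> R * (\<iota> b - x) * \<iota> c"
      by (simp add: \<iota>_mult left_diff_distrib right_diff_distrib)
    then have "norm (R * b * c) = norm (\<iota> R * (\<iota> b - x) * \<iota> c)" by (metis \<iota>_norm)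
    also have "\<dots> \<le> norm (\<iota> R) * norm (\<iota> b - x) * norm (\<iota> c)"
      by (meson norm_mult_ineq mult_right_mono norm_ge_zero order_trans)
    also have "\<dots> \<le> 1 * (1/2) * norm (\<iota> c)"
    proof (intro mult_right_mono mult_mono)
      have "projection R" unfolding R_def using r(2,4) L(1) by (rule projection_sum)
      then show "norm (\<iota> R) \<le> 1" by (simp add: \<iota>_norm norm_projection_le_1)
      show "norm (\<iota> b - x) \<le> 1/2" using x(2) by (simp add: norm_minus_commute)
    qed simp_all
    finally show ?thesis by (simp add: R_def \<iota>_norm)
  qed
  \<comment> \<open>But \<open>b\<close> spreads every \<open>c \<eta>\<close>, which lies in the range of \<open>r m\<close>; the two estimates together bound
    the norm of \<open>c\<close> by a proper fraction of itself.\<close>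
  have "norm (bop_apply c \<eta>) \<le> sqrt (1/2) * norm c * norm \<eta>" for \<eta>
  proof (rule power2_le_imp_le)
    define \<xi> where "\<xi> = bop_apply c \<eta>"
    have \<xi>: "bop_apply (r m) \<xi> = \<xi>" using rc by (metis \<xi>_def bop_apply_mult)
    have "(norm \<xi>)\<^sup>2 / 2 \<le> (norm c * norm \<eta> / 2)\<^sup>2"
    proof (rule field_le_epsilon)
      fix \<delta> :: real assume "\<delta> > 0"
      then obtain L where L: "finite L" "L \<inter> F = {}"
        "(norm \<xi>)\<^sup>2 / 2 - \<delta> \<le> (norm (bop_apply (\<Sum>l\<in>L. r l) (bop_apply b \<xi>)))\<^sup>2"
        using b[OF \<xi> F(1)] F(2) by (auto simp: m_def)
      have "norm (bop_apply (\<Sum>l\<in>L. r l) (bop_apply b \<xi>)) = norm (bop_apply ((\<Sum>l\<in>L. r l) * b * c) \<eta>)"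
        by (simp add: \<xi>_def bop_apply_mult)
      also have "\<dots> \<le> 1/2 * norm c * norm \<eta>"
        using norm_bop_apply mult_right_mono[OF small[OF L(1,2)] norm_ge_zero] by (rule order_trans)
      finally have "(norm (bop_apply (\<Sum>l\<in>L. r l) (bop_apply b \<xi>)))\<^sup>2 \<le> (norm c * norm \<eta> / 2)\<^sup>2"
        by (intro power_mono) simp_all
      with L(3) show "(norm \<xi>)\<^sup>2 / 2 \<le> (norm c * norm \<eta> / 2)\<^sup>2 + \<delta>" by linarith
    qed
    then show "(norm (bop_apply c \<eta>))\<^sup>2 \<le> (sqrt (1/2) * norm c * norm \<eta>)\<^sup>2"
      by (simp add: \<xi>_def power_mult_distrib power_divide field_simps)
  qed simp
  then have "norm c \<le> sqrt (1/2) * norm c" by (intro norm_bop_bound) simp_all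
  moreover have "sqrt (1/2 :: real) < 1" by simp
  ultimately show False using c by (simp add: mult_le_cancel_right1)
qed

end
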